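(* Let $n\ge1$, $t_1<\dots<t_{n+1}$, and for $\lambda>0$ let $\mathbf{H}(\lambda)=(\mathbf{I}+\lambda\mathbf{C}(2,n+2))^{-1}$. Then (1) $\lim_{\lambda\to0^+}\mathbf{H}(\lambda)=\mathbf{I}_{n+1}$; that is, as $\lambda\to0$ the minimizer of $\lambda(u_1,\boldsymbol{p}^T,u_{n+1})\mathbf{C}(u_1,\boldsymbol{p}^T,u_{n+1})^T+\|\boldsymbol{p}-\boldsymbol{y}\|^2$ converges to $u_1=u_{n+1}=0$, $\boldsymbol{p}=\boldsymbol{y}$; (2) for every $\boldsymbol{y}\in\mathbb{R}^{n+1}$, $$\lim_{\lambda\to+\infty}\mathbf{H}(\lambda)\boldsymbol{y}=\mathbf{L}(\mathbf{L}^T\mathbf{L})^{-1}\mathbf{L}^T\boldsymbol{y}=\pi_{R(\mathbf{L})}\boldsymbol{y},$$ where $\mathbf{L}$ is the $(n+1)\times2$ matrix with $i$-th row $(1,t_i)$ and $\pi_{R(\mathbf{L})}$ is the orthogonal projection onto its range; this limit, together with $u_1=u_{n+1}=0$, is the minimizer of $\|\boldsymbol{y}-\boldsymbol{p}\|^2$ subject to $\mathbf{C}(u_1,\boldsymbol{p}^T,u_{n+1})^T=0$.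
   Context: $S_3\cap C^2$ is the set of $C^2$ functions on $[t_1,t_{n+1}]$ that are cubic polynomials on each $[t_i,t_{i+1}]$. The natural basis: $\varphi_0\in S_3\cap C^2$ vanishes at all knots with $\varphi_0''(t_1)=1,\varphi_0''(t_{n+1})=0$; for $1\le j\le n+1$, $\varphi_j\in S_3\cap C^2$ has $\varphi_j(t_i)=\delta_{ij}$ and $\varphi_j''(t_1)=\varphi_j''(t_{n+1})=0$; $\varphi_{n+2}\in S_3\cap C^2$ vanishes at all knots with $\varphi_{n+2}''(t_1)=0,\varphi_{n+2}''(t_{n+1})=1$. $\mathbf{C}=[c_{k,l}]_{k,l=1}^{n+3}$ with $c_{k,l}=\int_{t_1}^{t_{n+1}}\varphi_{k-1}''\varphi_{l-1}''\,dt$, and $\mathbf{C}(2,n+2)=[c_{ij}:i,j=2,\dots,n+2]$. *)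

theory Defs
  imports "HOL-Analysis.Analysis" "HOL-Computational_Algebra.Polynomial"
          "Jordan_Normal_Form.Gauss_Jordan_Elimination"
begin

definition S3C2 :: "(nat \<Rightarrow> real) \<Rightarrow> nat \<Rightarrow> (real \<Rightarrow> real) \<Rightarrow> (real \<Rightarrow> real) \<Rightarrow> bool" where
  "S3C2 t n f f2 \<longleftrightarrow>
     (\<forall>i\<in>{1..n}. \<exists>p :: real poly. degree p \<le> 3 \<and> (\<forall>x\<in>{t i..t (Suc i)}. f x = poly p x)) \<and>
     (\<exists>f1. \<forall>x\<in>{t 1..t (n+1)}.
        (f has_real_derivative f1 x) (at x within {t 1..t (n+1)}) \<and>
        (f1 has_real_derivative f2 x) (at x within {t 1..t (n+1)})) \<and>
     continuous_on {t 1..t (n+1)} f2"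

definition basis_phi :: "(nat \<Rightarrow> real) \<Rightarrow> nat \<Rightarrow> nat \<Rightarrow> (real \<Rightarrow> real) \<Rightarrow> (real \<Rightarrow> real) \<Rightarrow> bool" where
  "basis_phi t n j f f2 \<longleftrightarrow> S3C2 t n f f2 \<and>
     (if j = 0 then (\<forall>i\<in>{1..n+1}. f (t i) = 0) \<and> f2 (t 1) = 1 \<and> f2 (t (n+1)) = 0
      else if j \<le> n + 1 then (\<forall>i\<in>{1..n+1}. f (t i) = (if i = j then 1 else 0)) \<and>
                             f2 (t 1) = 0 \<and> f2 (t (n+1)) = 0
      else (\<forall>i\<in>{1..n+1}. f (t i) = 0) \<and> f2 (t 1) = 0 \<and> f2 (t (n+1)) = 1)"

text \<open>Second derivative \<phi>_j'' (uniquely determined on [t 1, t (n+1)]).\<close>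
definition phi2 :: "(nat \<Rightarrow> real) \<Rightarrow> nat \<Rightarrow> nat \<Rightarrow> real \<Rightarrow> real" where
  "phi2 t n j = (SOME f2. \<exists>f. basis_phi t n j f f2)"

definition c_entry :: "(nat \<Rightarrow> real) \<Rightarrow> nat \<Rightarrow> nat \<Rightarrow> nat \<Rightarrow> real" where
  "c_entry t n k l = integral {t 1..t (n+1)} (\<lambda>x. phi2 t n (k - 1) x * phi2 t n (l - 1) x)"

text \<open>The full (n+3)x(n+3) matrix C (0-based JNF indices: entry (i,j) is c_{i+1,j+1}).\<close>
definition Cmat :: "(nat \<Rightarrow> real) \<Rightarrow> nat \<Rightarrow> real mat" where
  "Cmat t n = mat (n+3) (n+3) (\<lambda>(i,j). c_entry t n (i+1) (j+1))"

definition Csub :: "(nat \<Rightarrow> real) \<Rightarrow> nat \<Rightarrow> real mat" where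
  "Csub t n = mat (n+1) (n+1) (\<lambda>(i,j). c_entry t n (i+2) (j+2))"

definition Hmat :: "(nat \<Rightarrow> real) \<Rightarrow> nat \<Rightarrow> real \<Rightarrow> real mat" where
  "Hmat t n lam = the (mat_inverse (1\<^sub>m (n+1) + lam \<cdot>\<^sub>m Csub t n))"

definition Lmat :: "(nat \<Rightarrow> real) \<Rightarrow> nat \<Rightarrow> real mat" where
  "Lmat t n = mat (n+1) 2 (\<lambda>(i,j). if j = 0 then 1 else t (i+1))"

definition wvec :: "nat \<Rightarrow> real \<Rightarrow> real vec \<Rightarrow> real \<Rightarrow> real vec" where
  "wvec n u1 p u2 = vec (n+3) (\<lambda>i. if i = 0 then u1 else if i = n + 2 then u2 else p $ (i - 1))"

end

theory Submission
  imports Defs "Jordan_Normal_Form.Determinant"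
begin

text \<open>Both \<open>C\<close> and \<open>C(2,n+2)\<close> are Gram matrices of the functions \<open>\<phi>\<^sub>j''\<close> in
  \<open>L\<^sup>2[t 1, t (n+1)]\<close>, hence symmetric positive semidefinite.
  A cubic spline that vanishes at all knots and has \<open>f''(t 1) = f''(t (n+1)) = 0\<close> is linear:
  propagating \<open>(f', f'')\<close> from knot to knot, \<open>f'(t 1) \<noteq> 0\<close> would force \<open>f' f'' > 0\<close> at
  every later knot.  Hence \<open>\<Sum> w\<^sub>j \<phi>\<^sub>j'' = 0\<close> exactly when \<open>\<Sum> w\<^sub>j \<phi>\<^sub>j\<close> is a straight
  line, and the kernel of \<open>C(2,n+2)\<close> is the range of \<open>L\<close>.
  For positive semidefinite \<open>D\<close> the resolvent \<open>R = (I + \<lambda> D)\<^sup>-\<^sup>1\<close> is a contraction, so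
  \<open>R = I - \<lambda> R D \<rightarrow> I\<close> as \<open>\<lambda> \<rightarrow> 0\<close>.  Since \<open>D\<close> is symmetric, \<open>y = P y + D s\<close> with \<open>P\<close>
  the orthogonal projection onto \<open>ker D = range L\<close>, and \<open>R y = P y + (s - R s) / \<lambda> \<rightarrow> P y\<close>
  as \<open>\<lambda> \<rightarrow> \<infinity>\<close>.  The constrained minimisation is Pythagoras for \<open>P\<close>.\<close>

unbundle no vec_syntax and no inner_syntax

section \<open>Resolvents of positive semidefinite matrices\<close>

lemma conjugate_real_vec [simp]: "conjugate (v :: real vec) = v"
  by (simp add: conjugate_vec_def)

lemma scalar_prod_self_nonneg: "0 \<le> (v :: real vec) \<bullet> v"
  using conjugate_square_ge_0_vec[of v] by simp

lemma scalar_prod_self_eq_0_iff: "(v :: real vec) \<in> carrier_vec m \<Longrightarrow> v \<bullet> v = 0 \<longleftrightarrow> v = 0\<^sub>v m"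
  using conjugate_square_eq_0_vec[of v m] by simp

lemma component_sq_le_scalar_prod_self:
  assumes "(v :: real vec) \<in> carrier_vec m" "i < m"
  shows "(v $ i)\<^sup>2 \<le> v \<bullet> v"
proof -
  have "(v $ i)\<^sup>2 = (\<Sum>j\<in>{i}. (v $ j)\<^sup>2)" by simp
  also have "\<dots> \<le> (\<Sum>j\<in>{0..<m}. (v $ j)\<^sup>2)" by (rule sum_mono2) (use assms in auto)
  also have "\<dots> = v \<bullet> v" using assms by (simp add: scalar_prod_def power2_eq_square)
  finally show ?thesis .
qed

lemma mult_mat_vec_zero [simp]: "A \<in> carrier_mat m k \<Longrightarrow> A *\<^sub>v 0\<^sub>v k = (0\<^sub>v m :: 'a :: semiring_0 vec)"
  by (intro eq_vecI) auto

lemma scalar_prod_diff_self: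
  fixes x y :: "real vec"
  assumes "x \<in> carrier_vec m" "y \<in> carrier_vec m"
  shows "(x - y) \<bullet> (x - y) = x \<bullet> x - 2 * (x \<bullet> y) + y \<bullet> y"
  using assms by (simp add: minus_scalar_prod_distrib[of _ m] scalar_prod_minus_distrib[of _ m]
      comm_scalar_prod[of y m x])

lemma mat_inverse_of_injective:
  fixes A :: "'a :: field mat"
  assumes A: "A \<in> carrier_mat m m"
    and inj: "\<And>v. v \<in> carrier_vec m \<Longrightarrow> A *\<^sub>v v = 0\<^sub>v m \<Longrightarrow> v = 0\<^sub>v m"
  obtains B where "mat_inverse A = Some B" "A * B = 1\<^sub>m m" "B * A = 1\<^sub>m m" "B \<in> carrier_mat m m"
proof -
  have "det A \<noteq> 0" using det_0_iff_vec_prod_zero_field[OF A] inj by blast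
  then have "A \<in> Units (ring_mat TYPE('a) m ())" by (rule det_non_zero_imp_unit[OF A])
  then obtain B where "mat_inverse A = Some B" using mat_inverse(1)[OF A] by fastforce
  with mat_inverse(2)[OF A this] that show thesis by blast
qed

locale psd_matrix =
  fixes m :: nat and D :: "real mat"
  assumes D_carrier: "D \<in> carrier_mat m m"
    and psd: "\<And>v. v \<in> carrier_vec m \<Longrightarrow> 0 \<le> v \<bullet> (D *\<^sub>v v)"
begin

definition resolvent :: "real \<Rightarrow> real mat" where
  "resolvent lam = the (mat_inverse (1\<^sub>m m + lam \<cdot>\<^sub>m D))"

lemma shift_carrier: "1\<^sub>m m + lam \<cdot>\<^sub>m D \<in> carrier_mat m m"
  using D_carrier by simp

lemma shift_mult_vec:
  assumes "v \<in> carrier_vec m"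
  shows "(1\<^sub>m m + lam \<cdot>\<^sub>m D) *\<^sub>v v = v + lam \<cdot>\<^sub>v (D *\<^sub>v v)"
proof -
  have "(lam \<cdot>\<^sub>m D) *\<^sub>v v = lam \<cdot>\<^sub>v (D *\<^sub>v v)"
    using D_carrier assms by (intro eq_vecI) (auto simp: scalar_prod_def sum_distrib_left mult.assoc)
  then show ?thesis using D_carrier assms by (simp add: add_mult_distrib_mat_vec[of _ m m])
qed

lemma shift_form_ge:
  assumes "0 \<le> lam" "v \<in> carrier_vec m"
  shows "v \<bullet> v \<le> v \<bullet> ((1\<^sub>m m + lam \<cdot>\<^sub>m D) *\<^sub>v v)"
  using assms psd[of v] D_carrier
  by (simp add: shift_mult_vec scalar_prod_add_distrib[of _ m])

lemma resolvent_inverse: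
  assumes "0 \<le> lam"
  shows "(1\<^sub>m m + lam \<cdot>\<^sub>m D) * resolvent lam = 1\<^sub>m m"
    and "resolvent lam * (1\<^sub>m m + lam \<cdot>\<^sub>m D) = 1\<^sub>m m"
    and "resolvent lam \<in> carrier_mat m m"
proof -
  have inj: "v = 0\<^sub>v m" if v: "v \<in> carrier_vec m" and z: "(1\<^sub>m m + lam \<cdot>\<^sub>m D) *\<^sub>v v = 0\<^sub>v m" for v
  proof -
    have "v \<bullet> v \<le> 0" using shift_form_ge[OF assms v] z v by simp
    then show ?thesis using scalar_prod_self_nonneg[of v] scalar_prod_self_eq_0_iff[OF v] by simp
  qed
  obtain B where "mat_inverse (1\<^sub>m m + lam \<cdot>\<^sub>m D) = Some B"
    "(1\<^sub>m m + lam \<cdot>\<^sub>m D) * B = 1\<^sub>m m" "B * (1\<^sub>m m + lam \<cdot>\<^sub>m D) = 1\<^sub>m m" "B \<in> carrier_mat m m"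
    using mat_inverse_of_injective[OF shift_carrier inj] by blast
  then show "(1\<^sub>m m + lam \<cdot>\<^sub>m D) * resolvent lam = 1\<^sub>m m"
    "resolvent lam * (1\<^sub>m m + lam \<cdot>\<^sub>m D) = 1\<^sub>m m" "resolvent lam \<in> carrier_mat m m"
    unfolding resolvent_def by simp_all
qed

lemma resolvent_contraction:
  assumes lam: "0 \<le> lam" and s: "s \<in> carrier_vec m" and i: "i < m"
  shows "\<bar>(resolvent lam *\<^sub>v s) $ i\<bar> \<le> sqrt (s \<bullet> s)"
proof -
  define x where "x = resolvent lam *\<^sub>v s"
  have x: "x \<in> carrier_vec m" unfolding x_def using resolvent_inverse(3)[OF lam] s by simp
  have "(1\<^sub>m m + lam \<cdot>\<^sub>m D) *\<^sub>v x = s"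
    unfolding x_def using resolvent_inverse[OF lam] s
    by (simp flip: assoc_mult_mat_vec[OF shift_carrier resolvent_inverse(3)[OF lam] s])
  then have "x \<bullet> x \<le> x \<bullet> s" using shift_form_ge[OF lam x] by simp
  moreover have "0 \<le> (x - s) \<bullet> (x - s)" by (rule scalar_prod_self_nonneg)
  ultimately have "x \<bullet> x \<le> s \<bullet> s" using scalar_prod_diff_self[OF x s] by simp
  then have "(x $ i)\<^sup>2 \<le> s \<bullet> s" using component_sq_le_scalar_prod_self[OF x i] by linarith
  then show ?thesis unfolding x_def by (simp add: real_le_rsqrt)
qed

lemma resolvent_tendsto_one:
  assumes i: "i < m" and j: "j < m"
  shows "((\<lambda>lam. resolvent lam $$ (i,j)) \<longlongrightarrow> 1\<^sub>m m $$ (i,j)) (at_right 0)"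
proof -
  define K where "K = sqrt (col D j \<bullet> col D j)"
  have bound: "\<bar>resolvent lam $$ (i,j) - 1\<^sub>m m $$ (i,j)\<bar> \<le> lam * K" if lam: "0 < lam" for lam
  proof -
    let ?R = "resolvent lam"
    have R: "?R \<in> carrier_mat m m" using resolvent_inverse(3) lam by simp
    \<comment> \<open>\<open>R (I + \<lambda> D) = I\<close> gives \<open>R - I = - \<lambda> R D\<close>, and the columns of \<open>R D\<close> are \<open>R\<close>
      applied to those of \<open>D\<close>.\<close>
    have "?R * (1\<^sub>m m + lam \<cdot>\<^sub>m D) = ?R + lam \<cdot>\<^sub>m (?R * D)"
      using D_carrier
      by (subst mult_add_distrib_mat[OF R]) (auto simp: mult_smult_distrib[OF R D_carrier] right_mult_one_mat[OF R])
    then have "?R + lam \<cdot>\<^sub>m (?R * D) = 1\<^sub>m m" using resolvent_inverse(2) lam by simp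
    then have "?R $$ (i,j) - 1\<^sub>m m $$ (i,j) = - lam * (?R *\<^sub>v col D j) $ i"
      using R D_carrier i j by (auto dest!: arg_cong[where f = "\<lambda>A. A $$ (i,j)"])
    moreover have "\<bar>(?R *\<^sub>v col D j) $ i\<bar> \<le> K"
      unfolding K_def by (rule resolvent_contraction) (use lam D_carrier j i in auto)
    ultimately show ?thesis using lam by (simp add: abs_mult)
  qed
  have "((\<lambda>lam. resolvent lam $$ (i,j) - 1\<^sub>m m $$ (i,j)) \<longlongrightarrow> 0) (at_right 0)"
  proof (rule Lim_null_comparison)
    show "\<forall>\<^sub>F lam in at_right 0. norm (resolvent lam $$ (i,j) - 1\<^sub>m m $$ (i,j)) \<le> lam * K"
      using eventually_at_right_less[of 0] by eventually_elim (use bound in simp)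
    show "((\<lambda>lam. lam * K) \<longlongrightarrow> 0) (at_right 0)"
      by (rule tendsto_eq_intros) (auto intro: tendsto_ident_at)
  qed
  then show ?thesis by (simp add: Lim_null[symmetric])
qed

lemma resolvent_tendsto_kernel:
  assumes p: "p \<in> carrier_vec m" and Dp: "D *\<^sub>v p = 0\<^sub>v m" and s: "s \<in> carrier_vec m" and i: "i < m"
  shows "((\<lambda>lam. (resolvent lam *\<^sub>v (p + D *\<^sub>v s)) $ i) \<longlongrightarrow> p $ i) at_top"
proof -
  define K where "K = \<bar>s $ i\<bar> + sqrt (s \<bullet> s)"
  have bound: "\<bar>(resolvent lam *\<^sub>v (p + D *\<^sub>v s)) $ i - p $ i\<bar> \<le> K / lam" if lam: "0 < lam" for lam
  proof -
    let ?R = "resolvent lam" and ?A = "1\<^sub>m m + lam \<cdot>\<^sub>m D"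
    have R: "?R \<in> carrier_mat m m" and RA: "?R * ?A = 1\<^sub>m m" using resolvent_inverse lam by auto
    have Ds: "D *\<^sub>v s \<in> carrier_vec m" using D_carrier s by simp
    have RA_vec: "?R *\<^sub>v (?A *\<^sub>v v) = v" if "v \<in> carrier_vec m" for v
      using RA that by (simp flip: assoc_mult_mat_vec[OF R shift_carrier that])
    \<comment> \<open>\<open>R p = p\<close> and \<open>\<lambda> R D s = s - R s\<close>, where \<open>R s\<close> stays bounded.\<close>
    have "?A *\<^sub>v p = p" using shift_mult_vec[OF p] Dp p by (auto intro: eq_vecI)
    then have "?R *\<^sub>v p = p" using RA_vec[OF p] by simp
    moreover have "?R *\<^sub>v s + lam \<cdot>\<^sub>v (?R *\<^sub>v (D *\<^sub>v s)) = s"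
      using RA_vec[OF s] shift_mult_vec[OF s] s Ds
      by (simp add: mult_add_distrib_mat_vec[OF R] mult_mat_vec[OF R])
    ultimately have "(?R *\<^sub>v (p + D *\<^sub>v s)) $ i - p $ i = (s $ i - (?R *\<^sub>v s) $ i) / lam"
      using R p Ds i lam
      by (auto simp: mult_add_distrib_mat_vec[of _ m m] field_simps
          dest!: arg_cong[where f = "\<lambda>v. v $ i"])
    moreover have "\<bar>(?R *\<^sub>v s) $ i\<bar> \<le> sqrt (s \<bullet> s)" using resolvent_contraction lam s i by simp
    ultimately show ?thesis unfolding K_def using lam by (simp add: divide_right_mono)
  qed
  have "((\<lambda>lam. (resolvent lam *\<^sub>v (p + D *\<^sub>v s)) $ i - p $ i) \<longlongrightarrow> 0) at_top"
  proof (rule Lim_null_comparison)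
    show "\<forall>\<^sub>F lam in at_top. norm ((resolvent lam *\<^sub>v (p + D *\<^sub>v s)) $ i - p $ i) \<le> K / lam"
      using eventually_gt_at_top[of 0] by eventually_elim (use bound in simp)
    show "((\<lambda>lam. K / lam) \<longlongrightarrow> 0) at_top"
      by (rule tendsto_divide_0[OF tendsto_const filterlim_at_top_imp_at_infinity[OF filterlim_ident]])
  qed
  then show ?thesis by (simp add: Lim_null[symmetric])
qed

end

section \<open>Orthogonal projection onto the range of a matrix\<close>

lemma scalar_prod_add_self_orthogonal:
  fixes u w :: "real vec"
  assumes "u \<in> carrier_vec m" "w \<in> carrier_vec m" "u \<bullet> w = 0"
  shows "(u + w) \<bullet> (u + w) = u \<bullet> u + w \<bullet> w"
  using assms by (simp add: add_scalar_prod_distrib[of _ m] scalar_prod_add_distrib[of _ m]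
      comm_scalar_prod[of w m u])

definition proj_mat :: "real mat \<Rightarrow> real mat" where
  "proj_mat L = L * the (mat_inverse (transpose_mat L * L)) * transpose_mat L"

locale full_column_rank =
  fixes L :: "real mat" and m k :: nat
  assumes L_carrier: "L \<in> carrier_mat m k"
    and L_inj: "\<And>z. z \<in> carrier_vec k \<Longrightarrow> L *\<^sub>v z = 0\<^sub>v m \<Longrightarrow> z = 0\<^sub>v k"
begin

abbreviation gram_inv :: "real mat" where
  "gram_inv \<equiv> the (mat_inverse (transpose_mat L * L))"

lemma transpose_carrier: "transpose_mat L \<in> carrier_mat k m"
  using L_carrier by simp

lemma gram_inv_inverse:
  shows "(transpose_mat L * L) * gram_inv = 1\<^sub>m k"
    and "gram_inv * (transpose_mat L * L) = 1\<^sub>m k"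
    and "gram_inv \<in> carrier_mat k k"
proof -
  have LtL: "transpose_mat L * L \<in> carrier_mat k k" using L_carrier by simp
  have "z = 0\<^sub>v k" if z: "z \<in> carrier_vec k" and "(transpose_mat L * L) *\<^sub>v z = 0\<^sub>v k" for z
  proof -
    have "(L *\<^sub>v z) \<bullet> (L *\<^sub>v z) = (transpose_mat L *\<^sub>v (L *\<^sub>v z)) \<bullet> z"
      using transpose_vec_mult_scalar[OF L_carrier z, of "L *\<^sub>v z"] L_carrier z by simp
    also have "\<dots> = 0" using that L_carrier by simp
    finally show ?thesis using L_inj[OF z] scalar_prod_self_eq_0_iff[of "L *\<^sub>v z" m] L_carrier z by simp
  qed
  then obtain B where "mat_inverse (transpose_mat L * L) = Some B"
    "(transpose_mat L * L) * B = 1\<^sub>m k" "B * (transpose_mat L * L) = 1\<^sub>m k" "B \<in> carrier_mat k k"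
    using mat_inverse_of_injective[OF LtL] by blast
  then show "(transpose_mat L * L) * gram_inv = 1\<^sub>m k" "gram_inv * (transpose_mat L * L) = 1\<^sub>m k"
    "gram_inv \<in> carrier_mat k k" by simp_all
qed

lemma proj_mat_mult_vec:
  "y \<in> carrier_vec m \<Longrightarrow> proj_mat L *\<^sub>v y = L *\<^sub>v (gram_inv *\<^sub>v (transpose_mat L *\<^sub>v y))"
  unfolding proj_mat_def using L_carrier gram_inv_inverse(3) transpose_carrier
  by (simp add: assoc_mult_mat_vec[of _ m k _ m])

lemma proj_mat_mult_vec_carrier: "y \<in> carrier_vec m \<Longrightarrow> proj_mat L *\<^sub>v y \<in> carrier_vec m"
  using proj_mat_mult_vec L_carrier gram_inv_inverse(3) transpose_carrier by simp

lemma transpose_mult_gram_inv: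
  "w \<in> carrier_vec k \<Longrightarrow> transpose_mat L *\<^sub>v (L *\<^sub>v (gram_inv *\<^sub>v w)) = w"
  using L_carrier gram_inv_inverse(1,3)
  by (simp flip: assoc_mult_mat_vec[of _ k m _ k] assoc_mult_mat_vec[of _ k k _ k])

lemma transpose_mult_proj:
  "y \<in> carrier_vec m \<Longrightarrow> transpose_mat L *\<^sub>v (proj_mat L *\<^sub>v y) = transpose_mat L *\<^sub>v y"
  using proj_mat_mult_vec transpose_mult_gram_inv transpose_carrier by simp

lemma transpose_mult_residual:
  assumes y: "y \<in> carrier_vec m"
  shows "transpose_mat L *\<^sub>v (y - proj_mat L *\<^sub>v y) = 0\<^sub>v k"
  using transpose_mult_proj[OF y] proj_mat_mult_vec_carrier[OF y] y transpose_carrier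
  by (simp add: mult_minus_distrib_mat_vec[OF transpose_carrier])

lemma proj_orthogonal:
  assumes y: "y \<in> carrier_vec m" and z: "z \<in> carrier_vec k"
  shows "(y - proj_mat L *\<^sub>v y) \<bullet> (L *\<^sub>v z) = 0"
proof -
  have "(y - proj_mat L *\<^sub>v y) \<bullet> (L *\<^sub>v z) = (transpose_mat L *\<^sub>v (y - proj_mat L *\<^sub>v y)) \<bullet> z"
    using transpose_vec_mult_scalar[OF L_carrier z, of "y - proj_mat L *\<^sub>v y"] y
      proj_mat_mult_vec_carrier[OF y] by simp
  then show ?thesis using transpose_mult_residual[OF y] z by simp
qed

lemma proj_in_range: "y \<in> carrier_vec m \<Longrightarrow> \<exists>z\<in>carrier_vec k. proj_mat L *\<^sub>v y = L *\<^sub>v z"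
  using proj_mat_mult_vec gram_inv_inverse(3) transpose_carrier by auto

lemma proj_fixes_range:
  assumes z: "z \<in> carrier_vec k"
  shows "proj_mat L *\<^sub>v (L *\<^sub>v z) = L *\<^sub>v z"
proof -
  have "gram_inv *\<^sub>v (transpose_mat L *\<^sub>v (L *\<^sub>v z)) = (gram_inv * (transpose_mat L * L)) *\<^sub>v z"
    using assoc_mult_mat_vec[OF gram_inv_inverse(3) _ z, of "transpose_mat L * L"] L_carrier z by simp
  then show ?thesis using proj_mat_mult_vec[of "L *\<^sub>v z"] gram_inv_inverse(2) L_carrier z by simp
qed

lemma proj_least_squares:
  assumes y: "y \<in> carrier_vec m" and z: "z \<in> carrier_vec k"
  defines "P \<equiv> proj_mat L *\<^sub>v y"
  shows "(y - P) \<bullet> (y - P) \<le> (y - L *\<^sub>v z) \<bullet> (y - L *\<^sub>v z)"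
    and "(y - L *\<^sub>v z) \<bullet> (y - L *\<^sub>v z) \<le> (y - P) \<bullet> (y - P) \<Longrightarrow> L *\<^sub>v z = P"
proof -
  obtain z' where z': "z' \<in> carrier_vec k" and Pz': "P = L *\<^sub>v z'"
    using proj_in_range[OF y] unfolding P_def by blast
  have P: "P \<in> carrier_vec m" and Lz: "L *\<^sub>v z \<in> carrier_vec m"
    unfolding P_def using proj_mat_mult_vec_carrier y L_carrier z by auto
  \<comment> \<open>\<open>P - L z\<close> lies in the range of \<open>L\<close>, which is orthogonal to \<open>y - P\<close>.\<close>
  have "P - L *\<^sub>v z = L *\<^sub>v (z' - z)"
    unfolding Pz' using L_carrier z z' by (simp add: mult_minus_distrib_mat_vec)
  then have orth: "(y - P) \<bullet> (P - L *\<^sub>v z) = 0"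
    unfolding P_def using proj_orthogonal y z z' by simp
  have "y - L *\<^sub>v z = (y - P) + (P - L *\<^sub>v z)" using y P Lz L_carrier by (intro eq_vecI) auto
  then have pyth: "(y - L *\<^sub>v z) \<bullet> (y - L *\<^sub>v z) = (y - P) \<bullet> (y - P) + (P - L *\<^sub>v z) \<bullet> (P - L *\<^sub>v z)"
    using scalar_prod_add_self_orthogonal[OF _ _ orth, of m] y P Lz by simp
  then show "(y - P) \<bullet> (y - P) \<le> (y - L *\<^sub>v z) \<bullet> (y - L *\<^sub>v z)"
    using scalar_prod_self_nonneg[of "P - L *\<^sub>v z"] by simp
  assume "(y - L *\<^sub>v z) \<bullet> (y - L *\<^sub>v z) \<le> (y - P) \<bullet> (y - P)"
  then have "(P - L *\<^sub>v z) \<bullet> (P - L *\<^sub>v z) = 0"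
    using pyth scalar_prod_self_nonneg[of "P - L *\<^sub>v z"] by simp
  then have diff: "P - L *\<^sub>v z = 0\<^sub>v m"
    using scalar_prod_self_eq_0_iff[of "P - L *\<^sub>v z" m] P Lz by simp
  show "L *\<^sub>v z = P"
  proof (rule eq_vecI)
    fix i assume "i < dim_vec P"
    then have "(P - L *\<^sub>v z) $ i = P $ i - (L *\<^sub>v z) $ i" using P L_carrier by simp
    then show "(L *\<^sub>v z) $ i = P $ i" using arg_cong[OF diff, of "\<lambda>v. v $ i"] \<open>i < dim_vec P\<close> P
      by simp
  qed (use P L_carrier in simp)
qed

end

context full_column_rank
begin

lemma proj_mat_carrier: "proj_mat L \<in> carrier_mat m m"
  unfolding proj_mat_def using L_carrier gram_inv_inverse(3) by simp

lemma scalar_prod_proj_mat: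
  assumes v: "v \<in> carrier_vec m"
  shows "v \<bullet> (proj_mat L *\<^sub>v v) = (proj_mat L *\<^sub>v v) \<bullet> (proj_mat L *\<^sub>v v)"
proof -
  obtain w where w: "w \<in> carrier_vec k" and Pv: "proj_mat L *\<^sub>v v = L *\<^sub>v w"
    using proj_in_range[OF v] by blast
  have "v \<bullet> (L *\<^sub>v w) = (transpose_mat L *\<^sub>v v) \<bullet> w"
    using transpose_vec_mult_scalar[OF L_carrier w v] by simp
  also have "\<dots> = (transpose_mat L *\<^sub>v (proj_mat L *\<^sub>v v)) \<bullet> w" using transpose_mult_proj[OF v] by simp
  also have "\<dots> = (proj_mat L *\<^sub>v v) \<bullet> (L *\<^sub>v w)"
    using transpose_vec_mult_scalar[OF L_carrier w] proj_mat_carrier v by simp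
  finally show ?thesis using Pv by simp
qed

text \<open>A null vector of \<open>D + P\<close> would lie in the range of \<open>L\<close> and be killed by \<open>P\<close>.\<close>
lemma psd_plus_proj_mat_injective:
  assumes D_psd: "psd_matrix m D"
    and ker: "\<And>v. v \<in> carrier_vec m \<Longrightarrow> v \<bullet> (D *\<^sub>v v) = 0 \<Longrightarrow> \<exists>z\<in>carrier_vec k. v = L *\<^sub>v z"
    and v: "v \<in> carrier_vec m" and Ev: "(D + proj_mat L) *\<^sub>v v = 0\<^sub>v m"
  shows "v = 0\<^sub>v m"
proof -
  interpret psd_matrix m D by (rule D_psd)
  let ?P = "proj_mat L"
  have "v \<bullet> (D *\<^sub>v v) + (?P *\<^sub>v v) \<bullet> (?P *\<^sub>v v) = v \<bullet> ((D + ?P) *\<^sub>v v)"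
    using v proj_mat_carrier D_carrier scalar_prod_proj_mat[OF v]
    by (simp add: add_mult_distrib_mat_vec[of _ m m] scalar_prod_add_distrib[of _ m])
  also have "\<dots> = 0" using Ev v by simp
  finally have "v \<bullet> (D *\<^sub>v v) = 0" and Pv0: "(?P *\<^sub>v v) \<bullet> (?P *\<^sub>v v) = 0"
    using psd[OF v] scalar_prod_self_nonneg[of "?P *\<^sub>v v"] by linarith+
  then obtain z where z: "z \<in> carrier_vec k" and vz: "v = L *\<^sub>v z" using ker[OF v] by blast
  have "?P *\<^sub>v v = v" unfolding vz by (rule proj_fixes_range[OF z])
  then show ?thesis using Pv0 scalar_prod_self_eq_0_iff[OF v] by simp
qed

lemma transpose_mult_symmetric_kernel:
  assumes D: "D \<in> carrier_mat m m" and sym: "transpose_mat D = D"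
    and DL: "\<And>z. z \<in> carrier_vec k \<Longrightarrow> D *\<^sub>v (L *\<^sub>v z) = 0\<^sub>v m"
    and s: "s \<in> carrier_vec m"
  shows "transpose_mat L *\<^sub>v (D *\<^sub>v s) = 0\<^sub>v k"
proof -
  define u where "u = transpose_mat L *\<^sub>v (D *\<^sub>v s)"
  have Ds: "D *\<^sub>v s \<in> carrier_vec m" using D s by simp
  have u: "u \<in> carrier_vec k" unfolding u_def using Ds L_carrier by simp
  have "u \<bullet> u = (D *\<^sub>v s) \<bullet> (L *\<^sub>v u)"
    unfolding u_def using transpose_vec_mult_scalar[OF L_carrier u Ds] u_def by simp
  also have "\<dots> = s \<bullet> (D *\<^sub>v (L *\<^sub>v u))"
    using transpose_vec_mult_scalar[OF D _ s, of "L *\<^sub>v u"] sym L_carrier u by simp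
  finally have "u \<bullet> u = 0" using DL[OF u] s by simp
  then show ?thesis using scalar_prod_self_eq_0_iff[OF u] unfolding u_def by simp
qed

text \<open>Solve \<open>(D + P) s = r\<close>; applying \<open>L\<^sup>T\<close> then gives \<open>L\<^sup>T s = L\<^sup>T r = 0\<close>, hence \<open>P s = 0\<close>.\<close>
lemma psd_solvable_if_orthogonal_to_range:
  assumes D_psd: "psd_matrix m D" and sym: "transpose_mat D = D"
    and DL: "\<And>z. z \<in> carrier_vec k \<Longrightarrow> D *\<^sub>v (L *\<^sub>v z) = 0\<^sub>v m"
    and ker: "\<And>v. v \<in> carrier_vec m \<Longrightarrow> v \<bullet> (D *\<^sub>v v) = 0 \<Longrightarrow> \<exists>z\<in>carrier_vec k. v = L *\<^sub>v z"
    and r: "r \<in> carrier_vec m" and Lr: "transpose_mat L *\<^sub>v r = 0\<^sub>v k"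
  obtains s where "s \<in> carrier_vec m" "D *\<^sub>v s = r"
proof -
  interpret psd_matrix m D by (rule D_psd)
  let ?P = "proj_mat L"
  have DP: "D + ?P \<in> carrier_mat m m" using D_carrier proj_mat_carrier by simp
  obtain B where EB: "(D + ?P) * B = 1\<^sub>m m" and B: "B \<in> carrier_mat m m"
    using mat_inverse_of_injective[OF DP] psd_plus_proj_mat_injective[OF D_psd ker] by metis
  define s where "s = B *\<^sub>v r"
  have s: "s \<in> carrier_vec m" unfolding s_def using B r by simp
  have "(D + ?P) *\<^sub>v s = r"
    unfolding s_def using assoc_mult_mat_vec[OF DP B r] EB r by simp
  then have Es: "D *\<^sub>v s + ?P *\<^sub>v s = r"
    using add_mult_distrib_mat_vec[OF D_carrier proj_mat_carrier s] by simp
  have Ds: "D *\<^sub>v s \<in> carrier_vec m" and Ps: "?P *\<^sub>v s \<in> carrier_vec m"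
    using s D_carrier proj_mat_carrier by simp_all
  have LDs: "transpose_mat L *\<^sub>v (D *\<^sub>v s) = 0\<^sub>v k"
    by (rule transpose_mult_symmetric_kernel[OF D_carrier sym DL s])
  have "transpose_mat L *\<^sub>v r = transpose_mat L *\<^sub>v (D *\<^sub>v s) + transpose_mat L *\<^sub>v (?P *\<^sub>v s)"
    using Es Ds Ps by (simp flip: mult_add_distrib_mat_vec[OF transpose_carrier])
  then have "transpose_mat L *\<^sub>v s = 0\<^sub>v k"
    using Lr LDs transpose_mult_proj s transpose_carrier by simp
  then have "?P *\<^sub>v s = 0\<^sub>v m" using proj_mat_mult_vec s L_carrier gram_inv_inverse(3) by simp
  then have "D *\<^sub>v s = r" using Es Ds by simp
  with s show thesis by (rule that)
qed

end

section \<open>Gram matrices\<close>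

definition gram_mat :: "real set \<Rightarrow> nat \<Rightarrow> (nat \<Rightarrow> real \<Rightarrow> real) \<Rightarrow> real mat" where
  "gram_mat S m g = mat m m (\<lambda>(i,j). integral S (\<lambda>x. g i x * g j x))"

lemma integral_sq_eq_0_imp_0:
  fixes f :: "real \<Rightarrow> real"
  assumes ab: "a < b" and f: "continuous_on {a..b} f"
    and int0: "integral {a..b} (\<lambda>x. (f x)\<^sup>2) = 0" and x: "x \<in> {a..b}"
  shows "f x = 0"
proof -
  have cbox: "cbox a b = {a..b}" by simp
  have cont: "continuous_on (cbox a b) (\<lambda>x. (f x)\<^sup>2)"
    unfolding cbox using f by (intro continuous_intros)
  have "(\<lambda>x. (f x)\<^sup>2) integrable_on {a..b}"
    using f by (intro integrable_continuous_interval continuous_intros)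
  then have int: "((\<lambda>x. (f x)\<^sup>2) has_integral 0) (cbox a b)"
    unfolding cbox using int0 by (metis integrable_integral)
  have "box a b \<noteq> {}" "x \<in> cbox a b" using ab x by auto
  then have "(f x)\<^sup>2 = 0"
    using has_integral_0_cbox_imp_0[where f = "\<lambda>x. (f x)\<^sup>2", OF cont _ int] by simp
  then show ?thesis by simp
qed

context
  fixes a b :: real and m :: nat and g :: "nat \<Rightarrow> real \<Rightarrow> real"
  assumes g_cont: "\<And>l. l < m \<Longrightarrow> continuous_on {a..b} (g l)"
begin

lemma integral_sum_mult:
  assumes h: "continuous_on {a..b} h"
  shows "integral {a..b} (\<lambda>x. (\<Sum>l<m. c l * g l x) * h x)
       = (\<Sum>l<m. c l * integral {a..b} (\<lambda>x. g l x * h x))"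
proof -
  have int: "(\<lambda>x. c l * (g l x * h x)) integrable_on {a..b}" if "l \<in> {..<m}" for l
    using g_cont that h by (intro integrable_continuous_interval continuous_intros) auto
  have "(\<lambda>x. (\<Sum>l<m. c l * g l x) * h x) = (\<lambda>x. \<Sum>l<m. c l * (g l x * h x))"
    by (simp add: sum_distrib_right mult.assoc)
  then have "integral {a..b} (\<lambda>x. (\<Sum>l<m. c l * g l x) * h x)
      = (\<Sum>l<m. integral {a..b} (\<lambda>x. c l * (g l x * h x)))"
    using integral_sum[of "{..<m}", OF _ int] by simp
  then show ?thesis by simp
qed

lemma gram_mat_mult_vec:
  assumes v: "v \<in> carrier_vec m" and k: "k < m"
  shows "(gram_mat {a..b} m g *\<^sub>v v) $ k = integral {a..b} (\<lambda>x. (\<Sum>l<m. v $ l * g l x) * g k x)"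
proof -
  have "(gram_mat {a..b} m g *\<^sub>v v) $ k = (\<Sum>l<m. v $ l * integral {a..b} (\<lambda>x. g l x * g k x))"
    using v k by (simp add: gram_mat_def scalar_prod_def atLeast0LessThan mult.commute)
  also have "\<dots> = integral {a..b} (\<lambda>x. (\<Sum>l<m. v $ l * g l x) * g k x)"
    by (rule integral_sum_mult[symmetric, OF g_cont[OF k]])
  finally show ?thesis .
qed

lemma gram_mat_form:
  assumes v: "v \<in> carrier_vec m"
  shows "v \<bullet> (gram_mat {a..b} m g *\<^sub>v v) = integral {a..b} (\<lambda>x. (\<Sum>l<m. v $ l * g l x)\<^sup>2)"
proof -
  have comb: "continuous_on {a..b} (\<lambda>x. \<Sum>l<m. v $ l * g l x)"
    using g_cont by (intro continuous_intros) auto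
  have dim: "dim_vec (gram_mat {a..b} m g *\<^sub>v v) = m" by (simp add: gram_mat_def)
  have swap: "integral {a..b} (\<lambda>x. (\<Sum>l<m. v $ l * g l x) * g k x)
      = integral {a..b} (\<lambda>x. g k x * (\<Sum>l<m. v $ l * g l x))" for k
    by (simp add: mult.commute)
  have "v \<bullet> (gram_mat {a..b} m g *\<^sub>v v)
      = (\<Sum>k<m. v $ k * integral {a..b} (\<lambda>x. g k x * (\<Sum>l<m. v $ l * g l x)))"
    unfolding scalar_prod_def dim atLeast0LessThan
    by (intro sum.cong refl) (simp add: gram_mat_mult_vec[OF v] swap)
  also have "\<dots> = integral {a..b} (\<lambda>x. (\<Sum>l<m. v $ l * g l x)\<^sup>2)"
    by (simp add: integral_sum_mult[OF comb] power2_eq_square)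
  finally show ?thesis .
qed

lemma gram_mat_psd: "psd_matrix m (gram_mat {a..b} m g)"
proof
  show "gram_mat {a..b} m g \<in> carrier_mat m m" by (simp add: gram_mat_def)
  fix v :: "real vec" assume "v \<in> carrier_vec m"
  moreover have "continuous_on {a..b} (\<lambda>x. (\<Sum>l<m. v $ l * g l x)\<^sup>2)"
    using g_cont by (intro continuous_intros) auto
  ultimately show "0 \<le> v \<bullet> (gram_mat {a..b} m g *\<^sub>v v)"
    by (simp add: gram_mat_form integral_nonneg integrable_continuous_interval)
qed

lemma transpose_gram_mat: "transpose_mat (gram_mat {a..b} m g) = gram_mat {a..b} m g"
  by (intro eq_matI) (auto simp: gram_mat_def mult.commute)

lemma gram_mat_form_eq_0_iff:
  assumes ab: "a < b" and v: "v \<in> carrier_vec m"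
  shows "v \<bullet> (gram_mat {a..b} m g *\<^sub>v v) = 0 \<longleftrightarrow> (\<forall>x\<in>{a..b}. (\<Sum>l<m. v $ l * g l x) = 0)"
proof
  assume "v \<bullet> (gram_mat {a..b} m g *\<^sub>v v) = 0"
  moreover have "continuous_on {a..b} (\<lambda>x. \<Sum>l<m. v $ l * g l x)"
    using g_cont by (intro continuous_intros) auto
  ultimately show "\<forall>x\<in>{a..b}. (\<Sum>l<m. v $ l * g l x) = 0"
    using integral_sq_eq_0_imp_0[OF ab] gram_mat_form[OF v] by metis
next
  assume "\<forall>x\<in>{a..b}. (\<Sum>l<m. v $ l * g l x) = 0"
  then have "integral {a..b} (\<lambda>x. (\<Sum>l<m. v $ l * g l x)\<^sup>2) = integral {a..b} (\<lambda>_. 0)"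
    by (intro integral_cong) simp
  then show "v \<bullet> (gram_mat {a..b} m g *\<^sub>v v) = 0" by (simp add: gram_mat_form[OF v])
qed

lemma gram_mat_mult_vec_eq_0_iff:
  assumes ab: "a < b" and v: "v \<in> carrier_vec m"
  shows "gram_mat {a..b} m g *\<^sub>v v = 0\<^sub>v m \<longleftrightarrow> (\<forall>x\<in>{a..b}. (\<Sum>l<m. v $ l * g l x) = 0)"
proof
  assume "gram_mat {a..b} m g *\<^sub>v v = 0\<^sub>v m"
  then show "\<forall>x\<in>{a..b}. (\<Sum>l<m. v $ l * g l x) = 0"
    using gram_mat_form_eq_0_iff[OF ab v] v by simp
next
  assume "\<forall>x\<in>{a..b}. (\<Sum>l<m. v $ l * g l x) = 0"
  then have "integral {a..b} (\<lambda>x. (\<Sum>l<m. v $ l * g l x) * g k x) = integral {a..b} (\<lambda>_. 0)" for k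
    by (intro integral_cong) simp
  then have "(gram_mat {a..b} m g *\<^sub>v v) $ k = 0" if "k < m" for k
    using gram_mat_mult_vec[OF v that] by simp
  then show "gram_mat {a..b} m g *\<^sub>v v = 0\<^sub>v m"
    by (intro eq_vecI) (simp_all add: gram_mat_def)
qed

end

section \<open>Cubic splines\<close>

lemma poly_degree_le_3:
  fixes p :: "real poly"
  assumes "degree p \<le> 3"
  shows "poly p x = coeff p 0 + coeff p 1 * x + coeff p 2 * x\<^sup>2 + coeff p 3 * x ^ 3"
proof -
  have "poly p x = (\<Sum>i\<le>3. coeff p i * x ^ i)"
    unfolding poly_altdef
    by (rule sum.mono_neutral_left) (use assms in \<open>auto simp: coeff_eq_0 not_le\<close>)
  also have "{..3::nat} = {0, 1, 2, 3}" by auto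
  finally show ?thesis by simp
qed

lemma has_real_derivative_eq_on_interval:
  fixes f g :: "real \<Rightarrow> real"
  assumes ab: "a < b" and x: "x \<in> {a..b}" and fg: "\<forall>y\<in>{a..b}. f y = g y"
    and f': "(f has_real_derivative D) (at x within {a..b})"
    and g': "(g has_real_derivative E) (at x within {a..b})"
  shows "D = E"
proof -
  have "(g has_real_derivative D) (at x within {a..b})"
    using has_field_derivative_transform_within[OF f' _ x, of 1] fg by simp
  then show ?thesis
    using vector_derivative_unique_within_closed_interval[OF ab, of x g] x g'
    by (simp add: has_real_derivative_iff_has_vector_derivative)
qed

text \<open>A cubic vanishing at \<open>a < b\<close>: its first and second derivatives at \<open>b\<close> in terms of
  those at \<open>a\<close>.\<close>
lemma cubic_vanishing_at_ends:
  fixes a b c0 c1 c2 c3 :: real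
  assumes ab: "a < b" and qa: "c0 + c1 * a + c2 * a\<^sup>2 + c3 * a ^ 3 = 0"
    and qb: "c0 + c1 * b + c2 * b\<^sup>2 + c3 * b ^ 3 = 0"
  shows "c1 + 2 * c2 * b + 3 * c3 * b\<^sup>2
           = - 2 * (c1 + 2 * c2 * a + 3 * c3 * a\<^sup>2) - (2 * c2 + 6 * c3 * a) * (b - a) / 2"
    and "2 * c2 + 6 * c3 * b
           = - 2 * (2 * c2 + 6 * c3 * a) - 6 * (c1 + 2 * c2 * a + 3 * c3 * a\<^sup>2) / (b - a)"
proof -
  have "(b - a) * (c1 + c2 * (a + b) + c3 * (a\<^sup>2 + a * b + b\<^sup>2)) = 0"
    using qa qb by (simp add: algebra_simps power2_eq_square power3_eq_cube)
  then have E: "c1 + c2 * (a + b) + c3 * (a\<^sup>2 + a * b + b\<^sup>2) = 0" using ab by simp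
  show "c1 + 2 * c2 * b + 3 * c3 * b\<^sup>2
           = - 2 * (c1 + 2 * c2 * a + 3 * c3 * a\<^sup>2) - (2 * c2 + 6 * c3 * a) * (b - a) / 2"
    using E ab by (simp add: field_simps power2_eq_square)
  show "2 * c2 + 6 * c3 * b
           = - 2 * (2 * c2 + 6 * c3 * a) - 6 * (c1 + 2 * c2 * a + 3 * c3 * a\<^sup>2) / (b - a)"
    using E ab by (simp add: field_simps power2_eq_square)
qed

lemma recurrence_preserves_positive_product:
  fixes d M h :: real
  assumes "0 < d * M" "0 < h"
  shows "0 < (- 2 * d - M * h / 2) * (- 2 * M - 6 * d / h)"
proof -
  have "0 < d \<and> 0 < M \<or> d < 0 \<and> M < 0" using assms(1) by (auto simp: zero_less_mult_iff)
  then show ?thesis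
  proof
    assume dM: "0 < d \<and> 0 < M"
    then have "0 < M * h / 2" "0 < 6 * d / h" using assms(2) by simp_all
    then show ?thesis using dM by (intro mult_neg_neg) linarith+
  next
    assume dM: "d < 0 \<and> M < 0"
    then have "M * h / 2 < 0" "6 * d / h < 0" using assms(2) by (simp_all add: mult_neg_pos divide_neg_pos)
    then show ?thesis using dM by (intro mult_pos_pos) linarith+
  qed
qed

lemma positive_part_power_has_derivative:
  fixes u :: real
  assumes k: "2 \<le> k"
  shows "((\<lambda>u. (max u 0) ^ k) has_real_derivative real k * (max u 0) ^ (k - 1)) (at u)"
proof (cases "0 < u \<or> u < 0")
  case True
  then show ?thesis
  proof
    assume u: "0 < u"
    have "((\<lambda>u. u ^ k) has_real_derivative real k * u ^ (k - 1)) (at u)"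
      using DERIV_pow[of k u] by simp
    then have "((\<lambda>u. (max u 0) ^ k) has_real_derivative real k * u ^ (k - 1)) (at u)"
      by (rule has_field_derivative_transform_within_open[where S = "{0<..}"]) (use u in auto)
    then show ?thesis using u by simp
  next
    assume u: "u < 0"
    have "((\<lambda>u. 0) has_real_derivative 0) (at u)" by simp
    then have "((\<lambda>u. (max u 0) ^ k) has_real_derivative 0) (at u)"
      by (rule has_field_derivative_transform_within_open[where S = "{..<0}"]) (use u k in auto)
    then show ?thesis using u k by (simp add: power_0_left)
  qed
next
  case False
  then have u: "u = 0" by simp
  have "((\<lambda>y. (max y 0) ^ k / y) \<longlongrightarrow> 0) (at (0::real))"
  proof (rule Lim_null_comparison)
    show "\<forall>\<^sub>F y in at 0. norm ((max y 0) ^ k / y) \<le> \<bar>y\<bar> ^ (k - 1)"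
    proof (rule always_eventually, rule allI)
      fix y :: real
      have "\<bar>max y 0\<bar> ^ k \<le> \<bar>y\<bar> ^ k" by (rule power_mono) auto
      also have "\<bar>y\<bar> ^ k = \<bar>y\<bar> ^ (k - 1) * \<bar>y\<bar>" using k by (simp flip: power_Suc2)
      finally show "norm ((max y 0) ^ k / y) \<le> \<bar>y\<bar> ^ (k - 1)"
        by (cases "y = 0") (auto simp: abs_divide power_abs divide_le_eq)
    qed
    show "((\<lambda>y. \<bar>y\<bar> ^ (k - 1)) \<longlongrightarrow> 0) (at (0::real))"
      using k by (auto intro!: tendsto_eq_intros)
  qed
  then have "((\<lambda>u. (max u 0) ^ k) has_real_derivative 0) (at 0)"
    using k by (simp add: has_field_derivative_iff power_0_left)
  then show ?thesis using u k by (simp add: power_0_left)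
qed

lemma truncated_power_has_derivative:
  assumes "2 \<le> k"
  shows "((\<lambda>x::real. (max (x - c) 0) ^ k) has_real_derivative real k * (max (x - c) 0) ^ (k - 1)) (at x)"
  using DERIV_chain2[OF positive_part_power_has_derivative[OF assms] DERIV_diff[OF DERIV_ident DERIV_const]]
  by simp

definition cubic_spline ::
    "(nat \<Rightarrow> real) \<Rightarrow> nat \<Rightarrow> (real \<Rightarrow> real) \<Rightarrow> (real \<Rightarrow> real) \<Rightarrow> (real \<Rightarrow> real) \<Rightarrow> bool" where
  "cubic_spline t n f f1 f2 \<longleftrightarrow>
     (\<forall>i\<in>{1..n}. \<exists>p :: real poly. degree p \<le> 3 \<and> (\<forall>x\<in>{t i..t (Suc i)}. f x = poly p x)) \<and>
     (\<forall>x\<in>{t 1..t (n+1)}.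
        (f has_real_derivative f1 x) (at x within {t 1..t (n+1)}) \<and>
        (f1 has_real_derivative f2 x) (at x within {t 1..t (n+1)})) \<and>
     continuous_on {t 1..t (n+1)} f2"

lemma S3C2_iff_cubic_spline: "S3C2 t n f f2 \<longleftrightarrow> (\<exists>f1. cubic_spline t n f f1 f2)"
  unfolding S3C2_def cubic_spline_def by blast

lemma cubic_spline_affine: "cubic_spline t n (\<lambda>x. a + b * x) (\<lambda>_. b) (\<lambda>_. 0)"
  unfolding cubic_spline_def
  by (auto intro!: exI[of _ "[:a, b:]"] derivative_eq_intros)

lemma cubic_spline_add:
  assumes f: "cubic_spline t n f f1 f2" and g: "cubic_spline t n g g1 g2"
  shows "cubic_spline t n (\<lambda>x. c * f x + g x) (\<lambda>x. c * f1 x + g1 x) (\<lambda>x. c * f2 x + g2 x)"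
  unfolding cubic_spline_def
proof (intro conjI ballI)
  fix i assume i: "i \<in> {1..n}"
  obtain p :: "real poly" where p: "degree p \<le> 3" "\<forall>x\<in>{t i..t (Suc i)}. f x = poly p x"
    using f i unfolding cubic_spline_def by blast
  obtain q :: "real poly" where q: "degree q \<le> 3" "\<forall>x\<in>{t i..t (Suc i)}. g x = poly q x"
    using g i unfolding cubic_spline_def by blast
  have "degree (Polynomial.smult c p + q) \<le> 3"
    by (rule degree_add_le[OF order.trans[OF degree_smult_le p(1)] q(1)])
  then show "\<exists>p :: real poly. degree p \<le> 3 \<and> (\<forall>x\<in>{t i..t (Suc i)}. c * f x + g x = poly p x)"
    using p q by (intro exI[of _ "Polynomial.smult c p + q"]) simp
next
  fix x assume "x \<in> {t 1..t (n+1)}"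
  then have df: "(f has_real_derivative f1 x) (at x within {t 1..t (n+1)})"
      "(f1 has_real_derivative f2 x) (at x within {t 1..t (n+1)})"
    and dg: "(g has_real_derivative g1 x) (at x within {t 1..t (n+1)})"
      "(g1 has_real_derivative g2 x) (at x within {t 1..t (n+1)})"
    using f g unfolding cubic_spline_def by auto
  show "((\<lambda>x. c * f x + g x) has_real_derivative c * f1 x + g1 x) (at x within {t 1..t (n+1)})"
    by (rule DERIV_add[OF DERIV_cmult[OF df(1)] dg(1)])
  show "((\<lambda>x. c * f1 x + g1 x) has_real_derivative c * f2 x + g2 x) (at x within {t 1..t (n+1)})"
    by (rule DERIV_add[OF DERIV_cmult[OF df(2)] dg(2)])
next
  show "continuous_on {t 1..t (n+1)} (\<lambda>x. c * f2 x + g2 x)"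
    using f g unfolding cubic_spline_def by (auto intro!: continuous_intros)
qed

lemma cubic_spline_sum:
  assumes "finite L" "\<And>l. l \<in> L \<Longrightarrow> cubic_spline t n (f l) (f1 l) (f2 l)"
  shows "cubic_spline t n (\<lambda>x. \<Sum>l\<in>L. w l * f l x) (\<lambda>x. \<Sum>l\<in>L. w l * f1 l x)
           (\<lambda>x. \<Sum>l\<in>L. w l * f2 l x)"
  using assms
proof (induction L rule: finite_induct)
  case empty
  then show ?case using cubic_spline_affine[of t n 0 0] by simp
next
  case (insert a L)
  then show ?case using cubic_spline_add[of t n "f a" "f1 a" "f2 a"] by simp
qed

locale knots =
  fixes t :: "nat \<Rightarrow> real" and n :: nat
  assumes n_pos: "1 \<le> n" and knots_increasing: "\<forall>i\<in>{1..n}. t i < t (Suc i)"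
begin

abbreviation I :: "real set" where "I \<equiv> {t 1..t (n+1)}"

lemma knot_less: "1 \<le> i \<Longrightarrow> i < j \<Longrightarrow> j \<le> n + 1 \<Longrightarrow> t i < t j"
proof (induction j)
  case (Suc j)
  then have "t j < t (Suc j)" using knots_increasing by auto
  then show ?case using Suc by (cases "i = j") auto
qed simp

lemma knot_le: "1 \<le> i \<Longrightarrow> i \<le> j \<Longrightarrow> j \<le> n + 1 \<Longrightarrow> t i \<le> t j"
  using knot_less by (cases "i = j") (auto intro: less_imp_le)

lemma first_knot_less_last: "t 1 < t (n+1)"
  using knot_less n_pos by auto

lemma knot_interval_subset: "i \<in> {1..n} \<Longrightarrow> {t i..t (Suc i)} \<subseteq> I"
  using knot_le by auto

lemma knot_interval_cover:
  assumes "x \<in> I"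
  obtains i where "i \<in> {1..n}" "x \<in> {t i..t (Suc i)}"
proof -
  have "\<exists>i\<in>{1..m}. x \<in> {t i..t (Suc i)}" if "1 \<le> m" "m \<le> n" "x \<in> {t 1..t (m+1)}" for m
    using that
  proof (induction m)
    case (Suc m)
    show ?case
    proof (cases "1 \<le> m \<and> x \<le> t (m+1)")
      case True
      then show ?thesis using Suc by force
    next
      case False
      then have "x \<in> {t (Suc m)..t (Suc (Suc m))}" using Suc.prems by (cases "m = 0") auto
      then show ?thesis by auto
    qed
  qed simp
  then show ?thesis using assms n_pos that by blast
qed

lemma cubic_spline_on_knot_interval:
  assumes S: "cubic_spline t n f f1 f2" and i: "i \<in> {1..n}"
  obtains c0 c1 c2 c3 where "\<And>x. x \<in> {t i..t (Suc i)} \<Longrightarrow>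
      f x = c0 + c1 * x + c2 * x\<^sup>2 + c3 * x ^ 3 \<and> f1 x = c1 + 2 * c2 * x + 3 * c3 * x\<^sup>2
      \<and> f2 x = 2 * c2 + 6 * c3 * x"
proof -
  let ?J = "{t i..t (Suc i)}"
  obtain p :: "real poly" where "degree p \<le> 3" and fp: "\<forall>x\<in>?J. f x = poly p x"
    using S i unfolding cubic_spline_def by blast
  define c0 c1 c2 c3 where "c0 = coeff p 0" "c1 = coeff p 1" "c2 = coeff p 2" "c3 = coeff p 3"
  have f: "\<forall>x\<in>?J. f x = c0 + c1 * x + c2 * x\<^sup>2 + c3 * x ^ 3"
    using fp poly_degree_le_3[OF \<open>degree p \<le> 3\<close>] unfolding c0_c1_c2_c3_def by simp
  have ab: "t i < t (Suc i)" using knots_increasing i by auto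
  have derivs: "(f has_real_derivative f1 x) (at x within ?J) \<and> (f1 has_real_derivative f2 x) (at x within ?J)"
    if "x \<in> ?J" for x
    using S that knot_interval_subset[OF i] unfolding cubic_spline_def by (blast intro: DERIV_subset)
  have f1: "\<forall>x\<in>?J. f1 x = c1 + 2 * c2 * x + 3 * c3 * x\<^sup>2"
  proof
    fix x assume x: "x \<in> ?J"
    have "((\<lambda>x. c0 + c1 * x + c2 * x\<^sup>2 + c3 * x ^ 3) has_real_derivative
        c1 + 2 * c2 * x + 3 * c3 * x\<^sup>2) (at x within ?J)"
      by (auto intro!: derivative_eq_intros simp: power2_eq_square)
    then show "f1 x = c1 + 2 * c2 * x + 3 * c3 * x\<^sup>2"
      using has_real_derivative_eq_on_interval[OF ab x f] derivs[OF x] by blast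
  qed
  have "f2 x = 2 * c2 + 6 * c3 * x" if x: "x \<in> ?J" for x
  proof -
    have "((\<lambda>x. c1 + 2 * c2 * x + 3 * c3 * x\<^sup>2) has_real_derivative 2 * c2 + 6 * c3 * x) (at x within ?J)"
      by (auto intro!: derivative_eq_intros simp: power2_eq_square)
    then show ?thesis using has_real_derivative_eq_on_interval[OF ab x f1] derivs[OF x] by blast
  qed
  then show ?thesis using that f f1 by blast
qed

lemma cubic_spline_vanishing_recurrence:
  assumes S: "cubic_spline t n f f1 f2" and z: "\<forall>k\<in>{1..n+1}. f (t k) = 0" and i: "i \<in> {1..n}"
  shows "f1 (t (Suc i)) = - 2 * f1 (t i) - f2 (t i) * (t (Suc i) - t i) / 2"
    and "f2 (t (Suc i)) = - 2 * f2 (t i) - 6 * f1 (t i) / (t (Suc i) - t i)"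
proof -
  obtain c0 c1 c2 c3 where c: "\<And>x. x \<in> {t i..t (Suc i)} \<Longrightarrow>
      f x = c0 + c1 * x + c2 * x\<^sup>2 + c3 * x ^ 3 \<and> f1 x = c1 + 2 * c2 * x + 3 * c3 * x\<^sup>2
      \<and> f2 x = 2 * c2 + 6 * c3 * x"
    using cubic_spline_on_knot_interval[OF S i] by blast
  have ab: "t i < t (Suc i)" using knots_increasing i by auto
  then have "t i \<in> {t i..t (Suc i)}" "t (Suc i) \<in> {t i..t (Suc i)}" by auto
  note ca = c[OF this(1)] and cb = c[OF this(2)]
  have "c0 + c1 * t i + c2 * (t i)\<^sup>2 + c3 * t i ^ 3 = 0"
    and "c0 + c1 * t (Suc i) + c2 * (t (Suc i))\<^sup>2 + c3 * t (Suc i) ^ 3 = 0"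
    using ca cb z i by auto
  from cubic_vanishing_at_ends[OF ab this] ca cb
  show "f1 (t (Suc i)) = - 2 * f1 (t i) - f2 (t i) * (t (Suc i) - t i) / 2"
    and "f2 (t (Suc i)) = - 2 * f2 (t i) - 6 * f1 (t i) / (t (Suc i) - t i)" by simp_all
qed

text \<open>Starting from \<open>f''(t 1) = 0\<close>, the recurrence keeps \<open>f' f''\<close> strictly positive at all
  later knots.\<close>
lemma cubic_spline_vanishing_last_second_derivative:
  assumes S: "cubic_spline t n f f1 f2" and z: "\<forall>k\<in>{1..n+1}. f (t k) = 0"
    and f2_first: "f2 (t 1) = 0" and f1_first: "f1 (t 1) \<noteq> 0"
  shows "f2 (t (n+1)) \<noteq> 0"
proof -
  have "2 \<le> k \<Longrightarrow> k \<le> n + 1 \<Longrightarrow> 0 < f1 (t k) * f2 (t k)" for k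
  proof (induction k)
    case (Suc k)
    then have i: "k \<in> {1..n}" by auto
    have h: "0 < t (Suc k) - t k" using knots_increasing i by auto
    note rec = cubic_spline_vanishing_recurrence[OF S z i]
    show ?case
    proof (cases "k = 1")
      case True
      have "f1 (t (Suc k)) * f2 (t (Suc k)) = 12 * (f1 (t 1))\<^sup>2 / (t (Suc k) - t k)"
        using rec f2_first True by (simp add: power2_eq_square)
      then show ?thesis using f1_first h by simp
    next
      case False
      then show ?thesis
        using Suc rec recurrence_preserves_positive_product[OF _ h] by simp
    qed
  qed simp
  from this[of "n + 1"] show ?thesis using n_pos by auto
qed

lemma cubic_spline_vanishing_natural_second_derivative_eq_0:
  assumes S: "cubic_spline t n f f1 f2" and z: "\<forall>k\<in>{1..n+1}. f (t k) = 0"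
    and f2_first: "f2 (t 1) = 0" and f2_last: "f2 (t (n+1)) = 0"
  shows "\<forall>x\<in>I. f2 x = 0"
proof
  have f1_first: "f1 (t 1) = 0"
    using cubic_spline_vanishing_last_second_derivative[OF S z f2_first] f2_last by blast
  have knots0: "f1 (t k) = 0 \<and> f2 (t k) = 0" if "1 \<le> k" "k \<le> n + 1" for k
    using that
  proof (induction k)
    case (Suc k)
    show ?case
    proof (cases "k = 0")
      case True
      then show ?thesis using f1_first f2_first by simp
    next
      case False
      then have "k \<in> {1..n}" using Suc.prems by simp
      moreover have "f1 (t k) = 0 \<and> f2 (t k) = 0" using Suc False by simp
      ultimately show ?thesis using cubic_spline_vanishing_recurrence[OF S z] by simp
    qed
  qed simp
  fix x assume "x \<in> I"
  then obtain i where i: "i \<in> {1..n}" and x: "x \<in> {t i..t (Suc i)}" by (rule knot_interval_cover)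
  obtain c0 c1 c2 c3 where c: "\<And>y. y \<in> {t i..t (Suc i)} \<Longrightarrow> f2 y = 2 * c2 + 6 * c3 * y"
    using cubic_spline_on_knot_interval[OF S i] by metis
  have ab: "t i < t (Suc i)" using knots_increasing i by auto
  \<comment> \<open>\<open>f''\<close> is affine on the piece and vanishes at both of its ends.\<close>
  have "2 * c2 + 6 * c3 * t i = 0" "2 * c2 + 6 * c3 * t (Suc i) = 0"
    using c[of "t i"] c[of "t (Suc i)"] knots0[of i] knots0[of "Suc i"] i ab by auto
  moreover have "6 * c3 * (t (Suc i) - t i) = (2 * c2 + 6 * c3 * t (Suc i)) - (2 * c2 + 6 * c3 * t i)"
    by (simp add: algebra_simps)
  ultimately have "6 * c3 * (t (Suc i) - t i) = 0" by simp
  then have "c3 = 0" using ab by simp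
  then have "c2 = 0" using \<open>2 * c2 + 6 * c3 * t i = 0\<close> by simp
  then show "f2 x = 0" using c[OF x] \<open>c3 = 0\<close> by simp
qed


definition truncpow_spline :: "real \<Rightarrow> real \<Rightarrow> real \<Rightarrow> (nat \<Rightarrow> real) \<Rightarrow> real \<Rightarrow> real" where
  "truncpow_spline A B M e x = A + B * (x - t 1) + M / 2 * (x - t 1)\<^sup>2 + (\<Sum>j=1..n. e j * (max (x - t j) 0) ^ 3)"

definition truncpow_spline1 :: "real \<Rightarrow> real \<Rightarrow> (nat \<Rightarrow> real) \<Rightarrow> real \<Rightarrow> real" where
  "truncpow_spline1 B M e x = B + M * (x - t 1) + (\<Sum>j=1..n. e j * (3 * (max (x - t j) 0)\<^sup>2))"

definition truncpow_spline2 :: "real \<Rightarrow> (nat \<Rightarrow> real) \<Rightarrow> real \<Rightarrow> real" where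
  "truncpow_spline2 M e x = M + (\<Sum>j=1..n. e j * (6 * max (x - t j) 0))"

lemma truncpow_spline_on_knot_interval:
  assumes i: "i \<in> {1..n}" and x: "x \<in> {t i..t (Suc i)}"
  shows "truncpow_spline A B M e x = A + B * (x - t 1) + M / 2 * (x - t 1)\<^sup>2 + (\<Sum>j=1..i. e j * (x - t j) ^ 3)"
proof -
  have "max (x - t j) 0 = (if j \<le> i then x - t j else 0)" if "j \<in> {1..n}" for j
    using knot_le[of j i] knot_le[of "Suc i" j] i x that by auto
  then have "(\<Sum>j=1..n. e j * (max (x - t j) 0) ^ 3) = (\<Sum>j=1..n. if j \<le> i then e j * (x - t j) ^ 3 else 0)"
    by (intro sum.cong) auto
  also have "\<dots> = (\<Sum>j=1..i. e j * (x - t j) ^ 3)"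
    by (rule sum.mono_neutral_cong_right) (use i in auto)
  finally show ?thesis unfolding truncpow_spline_def by simp
qed

lemma truncpow_spline_at_knot:
  assumes k: "k \<in> {1..n+1}"
  shows "truncpow_spline A B M e (t k)
           = A + B * (t k - t 1) + M / 2 * (t k - t 1)\<^sup>2 + (\<Sum>j\<in>{1..<k}. e j * (t k - t j) ^ 3)"
proof -
  have "max (t k - t j) 0 = (if j < k then t k - t j else 0)" if "j \<in> {1..n}" for j
    using knot_le[of j k] knot_le[of k j] k that by auto
  then have "(\<Sum>j=1..n. e j * (max (t k - t j) 0) ^ 3) = (\<Sum>j=1..n. if j < k then e j * (t k - t j) ^ 3 else 0)"
    by (intro sum.cong) auto
  also have "\<dots> = (\<Sum>j\<in>{1..<k}. e j * (t k - t j) ^ 3)"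
    by (rule sum.mono_neutral_cong_right) (use k in auto)
  finally show ?thesis unfolding truncpow_spline_def by simp
qed

lemma truncpow_spline_first_knot: "truncpow_spline A B M e (t 1) = A"
  using truncpow_spline_at_knot[of 1] by simp

lemma truncpow_spline1_first_knot: "truncpow_spline1 B M e (t 1) = B"
  using knot_le by (simp add: truncpow_spline1_def)

lemma truncpow_spline2_first_knot: "truncpow_spline2 M e (t 1) = M"
  using knot_le by (simp add: truncpow_spline2_def)

lemma truncpow_spline_has_derivative:
  "(truncpow_spline A B M e has_real_derivative truncpow_spline1 B M e x) (at x)"
proof -
  have "((\<lambda>x. \<Sum>j=1..n. e j * (max (x - t j) 0) ^ 3) has_real_derivative
      (\<Sum>j=1..n. e j * (3 * (max (x - t j) 0)\<^sup>2))) (at x)"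
    by (intro DERIV_sum DERIV_cmult) (use truncated_power_has_derivative[of 3] in simp)
  moreover have "((\<lambda>x. A + B * (x - t 1) + M / 2 * (x - t 1)\<^sup>2) has_real_derivative B + M * (x - t 1)) (at x)"
    by (auto intro!: derivative_eq_intros simp: field_simps)
  ultimately show ?thesis
    unfolding truncpow_spline_def[abs_def] truncpow_spline1_def using DERIV_add by fastforce
qed

lemma truncpow_spline1_has_derivative:
  "(truncpow_spline1 B M e has_real_derivative truncpow_spline2 M e x) (at x)"
proof -
  have "((\<lambda>x. \<Sum>j=1..n. e j * (3 * (max (x - t j) 0)\<^sup>2)) has_real_derivative
      (\<Sum>j=1..n. e j * (6 * max (x - t j) 0))) (at x)"
    by (intro DERIV_sum DERIV_cmult) (use DERIV_cmult[OF truncated_power_has_derivative[of 2], of 3] in simp)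
  moreover have "((\<lambda>x. B + M * (x - t 1)) has_real_derivative M) (at x)"
    by (auto intro!: derivative_eq_intros)
  ultimately show ?thesis
    unfolding truncpow_spline1_def[abs_def] truncpow_spline2_def using DERIV_add by fastforce
qed

lemma cubic_spline_truncpow_spline:
  "cubic_spline t n (truncpow_spline A B M e) (truncpow_spline1 B M e) (truncpow_spline2 M e)"
  unfolding cubic_spline_def
proof (intro conjI ballI)
  fix i assume i: "i \<in> {1..n}"
  let ?X = "\<lambda>c::real. [:- c, 1:]"
  define p where "p = [:A:] + Polynomial.smult B (?X (t 1)) + Polynomial.smult (M / 2) (?X (t 1) ^ 2)
     + (\<Sum>j=1..i. Polynomial.smult (e j) (?X (t j) ^ 3))"
  have deg: "degree (?X c ^ k) \<le> k" for c k
    using degree_power_le[of "?X c" k] by simp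
  have "degree p \<le> 3"
    unfolding p_def
    by (intro degree_add_le degree_sum_le order.trans[OF degree_smult_le])
      (auto intro: order.trans[OF deg])
  moreover have "truncpow_spline A B M e x = poly p x" if "x \<in> {t i..t (Suc i)}" for x
    unfolding truncpow_spline_on_knot_interval[OF i that] p_def by (simp add: poly_sum algebra_simps)
  ultimately show "\<exists>p :: real poly. degree p \<le> 3 \<and> (\<forall>x\<in>{t i..t (Suc i)}. truncpow_spline A B M e x = poly p x)"
    by blast
next
  fix x
  show "(truncpow_spline A B M e has_real_derivative truncpow_spline1 B M e x) (at x within I)"
    and "(truncpow_spline1 B M e has_real_derivative truncpow_spline2 M e x) (at x within I)"
    by (rule has_field_derivative_at_within, rule truncpow_spline_has_derivative
        truncpow_spline1_has_derivative)+
next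
  show "continuous_on I (truncpow_spline2 M e)"
    unfolding truncpow_spline2_def by (intro continuous_intros)
qed

text \<open>Each coefficient \<open>e\<^sub>j\<close> first acts at knot \<open>j + 1\<close>, so the interpolation conditions can
  be met one knot at a time.\<close>
lemma truncpow_spline_interpolates: "\<exists>e. \<forall>k\<in>{2..n+1}. truncpow_spline A B M e (t k) = y k"
proof -
  have "\<exists>e. \<forall>k\<in>{2..m+1}. truncpow_spline A B M e (t k) = y k" if "m \<le> n" for m
    using that
  proof (induction m)
    case (Suc m)
    then obtain e where e: "\<forall>k\<in>{2..m+1}. truncpow_spline A B M e (t k) = y k" by auto
    let ?k = "Suc (Suc m)"
    have k: "?k \<in> {1..n+1}" and h: "t (Suc m) < t ?k" using Suc.prems knot_less by auto
    define base where "base = truncpow_spline A B M e (t ?k) - e (Suc m) * (t ?k - t (Suc m)) ^ 3"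
    define e' where "e' = e(Suc m := (y ?k - base) / (t ?k - t (Suc m)) ^ 3)"
    have same: "truncpow_spline A B M e' (t k) = truncpow_spline A B M e (t k) + (e' (Suc m) - e (Suc m)) *
        (if Suc m < k then (t k - t (Suc m)) ^ 3 else 0)" if "k \<in> {1..n+1}" for k
      unfolding truncpow_spline_at_knot[OF that] e'_def
      by (cases "Suc m < k") (auto simp: sum.remove[where x = "Suc m"] algebra_simps intro!: sum.cong)
    have "truncpow_spline A B M e' (t k) = y k" if "k \<in> {2..Suc m + 1}" for k
    proof (cases "k = ?k")
      case True
      have "0 < (t ?k - t (Suc m)) ^ 3" using h by simp
      then show ?thesis using same[OF k] True unfolding base_def e'_def by (simp add: field_simps)
    next
      case False
      then show ?thesis using same[of k] e that Suc.prems by auto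
    qed
    then show ?case by blast
  qed simp
  then show ?thesis by blast
qed

lemma cubic_spline_exists:
  obtains f f1 f2 where "cubic_spline t n f f1 f2" "\<forall>k\<in>{1..n+1}. f (t k) = y k"
    "f2 (t 1) = M\<^sub>1" "f2 (t (n+1)) = M\<^sub>2"
proof -
  obtain e\<^sub>0 where e\<^sub>0: "\<forall>k\<in>{2..n+1}. truncpow_spline 0 1 0 e\<^sub>0 (t k) = 0"
    using truncpow_spline_interpolates[of 0 1 0 "\<lambda>_. 0"] by blast
  obtain e where e: "\<forall>k\<in>{2..n+1}. truncpow_spline (y 1) 0 M\<^sub>1 e (t k) = y k"
    using truncpow_spline_interpolates[of "y 1" 0 "M\<^sub>1" y] by blast
  let ?h = "truncpow_spline 0 1 0 e\<^sub>0" and ?h2 = "truncpow_spline2 0 e\<^sub>0"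
  let ?g = "truncpow_spline (y 1) 0 M\<^sub>1 e" and ?g2 = "truncpow_spline2 M\<^sub>1 e"
  have h_knots: "\<forall>k\<in>{1..n+1}. ?h (t k) = 0" and g_knots: "\<forall>k\<in>{1..n+1}. ?g (t k) = y k"
  proof (safe)
    fix k assume k: "k \<in> {1..n+1}"
    then consider "k = 1" | "k \<in> {2..n+1}" by fastforce
    then have "?h (t k) = 0 \<and> ?g (t k) = y k"
      by cases (use e\<^sub>0 e truncpow_spline_first_knot in auto)
    then show "?h (t k) = 0" and "?g (t k) = y k" by simp_all
  qed
  \<comment> \<open>\<open>h\<close> vanishes at the knots and \<open>h'(t 1) = 1\<close>, so \<open>h''(t (n+1)) \<noteq> 0\<close>: adding a
    multiple of \<open>h\<close> to \<open>g\<close> adjusts the last second derivative.\<close>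
  have "truncpow_spline1 1 0 e\<^sub>0 (t 1) \<noteq> 0" using truncpow_spline1_first_knot[of 1 0 e\<^sub>0] by simp
  then have "?h2 (t (n+1)) \<noteq> 0"
    by (rule cubic_spline_vanishing_last_second_derivative[OF cubic_spline_truncpow_spline h_knots
          truncpow_spline2_first_knot])
  define c where "c = (M\<^sub>2 - ?g2 (t (n+1))) / ?h2 (t (n+1))"
  show thesis
  proof (rule that)
    show "cubic_spline t n (\<lambda>x. c * ?h x + ?g x) (\<lambda>x. c * truncpow_spline1 1 0 e\<^sub>0 x + truncpow_spline1 0 M\<^sub>1 e x)
        (\<lambda>x. c * ?h2 x + ?g2 x)"
      by (rule cubic_spline_add[OF cubic_spline_truncpow_spline cubic_spline_truncpow_spline])
    show "\<forall>k\<in>{1..n+1}. c * ?h (t k) + ?g (t k) = y k" using h_knots g_knots by simp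
    show "c * ?h2 (t 1) + ?g2 (t 1) = M\<^sub>1" unfolding truncpow_spline2_first_knot by simp
    show "c * ?h2 (t (n+1)) + ?g2 (t (n+1)) = M\<^sub>2" using \<open>?h2 (t (n+1)) \<noteq> 0\<close> unfolding c_def by simp
  qed
qed

lemma basis_phi_exists: "\<exists>f f2. basis_phi t n j f f2"
proof -
  obtain f f1 f2 where "cubic_spline t n f f1 f2"
    and "\<forall>k\<in>{1..n+1}. f (t k) = (if 1 \<le> j \<and> j \<le> n + 1 \<and> k = j then 1 else 0)"
    and "f2 (t 1) = (if j = 0 then 1 else 0)" and "f2 (t (n+1)) = (if n + 1 < j then 1 else 0)"
    by (rule cubic_spline_exists)
  then have "basis_phi t n j f f2"
    unfolding basis_phi_def S3C2_iff_cubic_spline using n_pos by auto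
  then show ?thesis by blast
qed


section \<open>The natural basis and the matrix C\<close>

definition phi :: "nat \<Rightarrow> real \<Rightarrow> real" where
  "phi j = (SOME f. basis_phi t n j f (phi2 t n j))"

definition phi1 :: "nat \<Rightarrow> real \<Rightarrow> real" where
  "phi1 j = (SOME f1. cubic_spline t n (phi j) f1 (phi2 t n j))"

lemma basis_phi_phi: "basis_phi t n j (phi j) (phi2 t n j)"
proof -
  have "\<exists>f. basis_phi t n j f (phi2 t n j)"
    unfolding phi2_def
    by (rule someI_ex[where P = "\<lambda>f2. \<exists>f. basis_phi t n j f f2"]) (use basis_phi_exists in blast)
  then show ?thesis unfolding phi_def by (rule someI_ex)
qed

lemma cubic_spline_phi: "cubic_spline t n (phi j) (phi1 j) (phi2 t n j)"
proof -
  have "\<exists>f1. cubic_spline t n (phi j) f1 (phi2 t n j)"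
    using basis_phi_phi unfolding basis_phi_def S3C2_iff_cubic_spline by blast
  then show ?thesis unfolding phi1_def by (rule someI_ex)
qed

lemma continuous_on_phi2: "continuous_on I (phi2 t n j)"
  using cubic_spline_phi unfolding cubic_spline_def by blast

definition phi_comb :: "(nat \<Rightarrow> real) \<Rightarrow> real \<Rightarrow> real" where
  "phi_comb w x = (\<Sum>l<n+3. w l * phi l x)"

definition phi2_comb :: "(nat \<Rightarrow> real) \<Rightarrow> real \<Rightarrow> real" where
  "phi2_comb w x = (\<Sum>l<n+3. w l * phi2 t n l x)"

lemma cubic_spline_phi_comb:
  "cubic_spline t n (phi_comb w) (\<lambda>x. \<Sum>l<n+3. w l * phi1 l x) (phi2_comb w)"
  unfolding phi_comb_def[abs_def] phi2_comb_def[abs_def]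
  by (rule cubic_spline_sum) (simp_all add: cubic_spline_phi)

lemma phi_comb_at_knot:
  assumes i: "i \<in> {1..n+1}"
  shows "phi_comb w (t i) = w i"
proof -
  have "phi l (t i) = (if l = i then 1 else 0)" for l
    using basis_phi_phi[of l] i unfolding basis_phi_def by (auto split: if_splits)
  then have "phi_comb w (t i) = (\<Sum>l<n+3. if l = i then w l else 0)"
    unfolding phi_comb_def by (intro sum.cong) auto
  also have "\<dots> = w i" using i by (simp add: sum.delta')
  finally show ?thesis .
qed

lemma phi2_comb_first_knot: "phi2_comb w (t 1) = w 0"
proof -
  have "phi2 t n l (t 1) = (if l = 0 then 1 else 0)" for l
    using basis_phi_phi[of l] unfolding basis_phi_def by (auto split: if_splits)
  then have "phi2_comb w (t 1) = (\<Sum>l<n+3. if l = 0 then w l else 0)"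
    unfolding phi2_comb_def by (intro sum.cong) auto
  then show ?thesis by (simp add: sum.delta')
qed

lemma phi2_comb_last_knot: "phi2_comb w (t (n+1)) = w (n+2)"
proof -
  have "phi2 t n l (t (n+1)) = (if l = n + 2 then 1 else 0)" if "l \<le> n + 2" for l
    using basis_phi_phi[of l] that unfolding basis_phi_def by (cases "l = n + 2") (auto split: if_splits)
  then have "phi2_comb w (t (n+1)) = (\<Sum>l<n+3. if l = n + 2 then w l else 0)"
    unfolding phi2_comb_def by (intro sum.cong) auto
  then show ?thesis by (simp add: sum.delta')
qed

text \<open>\<open>\<Sum> w\<^sub>j \<phi>\<^sub>j'' = 0\<close> says exactly that \<open>\<Sum> w\<^sub>j \<phi>\<^sub>j\<close> is a straight line.\<close>
lemma phi2_comb_eq_0_iff: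
  "(\<forall>x\<in>I. phi2_comb w x = 0) \<longleftrightarrow>
     w 0 = 0 \<and> w (n+2) = 0 \<and> (\<exists>a b. \<forall>i\<in>{1..n+1}. w i = a + b * t i)"
proof
  assume z: "\<forall>x\<in>I. phi2_comb w x = 0"
  let ?f1 = "\<lambda>x. \<Sum>l<n+3. w l * phi1 l x"
  have derivs: "(phi_comb w has_real_derivative ?f1 x) (at x within I)"
    "(?f1 has_real_derivative phi2_comb w x) (at x within I)" if "x \<in> I" for x
    using cubic_spline_phi_comb[of w] that unfolding cubic_spline_def by blast+
  obtain b where b: "\<forall>x\<in>I. ?f1 x = b"
    using has_field_derivative_zero_constant[of I ?f1] derivs(2) z by auto
  have "((\<lambda>x. phi_comb w x - b * x) has_real_derivative 0) (at x within I)" if "x \<in> I" for x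
    using DERIV_diff[OF derivs(1)[OF that] DERIV_cmult[OF DERIV_ident, of b]] b that by simp
  then obtain a where a: "\<forall>x\<in>I. phi_comb w x - b * x = a"
    using has_field_derivative_zero_constant[of I "\<lambda>x. phi_comb w x - b * x"] by auto
  have "w i = a + b * t i" if i: "i \<in> {1..n+1}" for i
  proof -
    have "t i \<in> I" using knot_le i by auto
    then have "phi_comb w (t i) - b * t i = a" using a by blast
    then show ?thesis using phi_comb_at_knot[OF i] by simp
  qed
  moreover have "t 1 \<in> I" "t (n+1) \<in> I" using first_knot_less_last by auto
  then have "w 0 = 0" "w (n+2) = 0"
    using z phi2_comb_first_knot phi2_comb_last_knot by metis+
  ultimately show "w 0 = 0 \<and> w (n+2) = 0 \<and> (\<exists>a b. \<forall>i\<in>{1..n+1}. w i = a + b * t i)" by blast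
next
  assume "w 0 = 0 \<and> w (n+2) = 0 \<and> (\<exists>a b. \<forall>i\<in>{1..n+1}. w i = a + b * t i)"
  then obtain a b where w0: "w 0 = 0" and wn: "w (n+2) = 0" and ab: "\<forall>i\<in>{1..n+1}. w i = a + b * t i"
    by blast
  \<comment> \<open>Subtracting the line through the knot values leaves a spline vanishing at all knots.\<close>
  note S = cubic_spline_add[OF cubic_spline_affine cubic_spline_phi_comb, of "- 1" a b w]
  have "\<forall>k\<in>{1..n+1}. - 1 * (a + b * t k) + phi_comb w (t k) = 0"
    using ab phi_comb_at_knot by simp
  moreover have "- 1 * 0 + phi2_comb w (t 1) = 0" "- 1 * 0 + phi2_comb w (t (n+1)) = 0"
    unfolding phi2_comb_first_knot phi2_comb_last_knot using w0 wn by simp_all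
  ultimately have "\<forall>x\<in>I. - 1 * 0 + phi2_comb w x = 0"
    by (rule cubic_spline_vanishing_natural_second_derivative_eq_0[OF S])
  then show "\<forall>x\<in>I. phi2_comb w x = 0" by simp
qed


lemma Cmat_eq_gram_mat: "Cmat t n = gram_mat I (n+3) (phi2 t n)"
  by (intro eq_matI) (auto simp: Cmat_def gram_mat_def c_entry_def)

lemma Csub_eq_gram_mat: "Csub t n = gram_mat I (n+1) (\<lambda>j. phi2 t n (Suc j))"
  by (intro eq_matI) (auto simp: Csub_def gram_mat_def c_entry_def)

lemma Lmat_mult_vec:
  assumes "z \<in> carrier_vec 2" "i < n + 1"
  shows "(Lmat t n *\<^sub>v z) $ i = z $ 0 + z $ 1 * t (Suc i)"
proof -
  have "{0..<2::nat} = {0, 1}" by auto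
  then show ?thesis using assms by (simp add: Lmat_def scalar_prod_def)
qed

lemma Lmat_full_column_rank: "full_column_rank (Lmat t n) (n+1) 2"
proof
  show "Lmat t n \<in> carrier_mat (n+1) 2" by (simp add: Lmat_def)
  fix z :: "real vec" assume z: "z \<in> carrier_vec 2" and Lz: "Lmat t n *\<^sub>v z = 0\<^sub>v (n+1)"
  have e: "z $ 0 + z $ 1 * t 1 = 0" "z $ 0 + z $ 1 * t 2 = 0"
    using Lmat_mult_vec[OF z, of 0] Lmat_mult_vec[OF z, of 1] Lz n_pos by (auto simp: numeral_2_eq_2)
  have "z $ 1 * t 2 - z $ 1 * t 1 = 0" using e by linarith
  then have "z $ 1 * (t 2 - t 1) = 0" by (simp add: right_diff_distrib)
  moreover have "t 1 < t 2" using knot_less[of 1 2] n_pos by simp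
  ultimately have "z $ 1 = 0" by simp
  then have "z $ 0 = 0" using e by simp
  show "z = 0\<^sub>v 2"
  proof (rule eq_vecI)
    fix i assume "i < dim_vec (0\<^sub>v 2 :: real vec)"
    then have "i = 0 \<or> i = 1" by auto
    then show "z $ i = 0\<^sub>v 2 $ i" using \<open>z $ 0 = 0\<close> \<open>z $ 1 = 0\<close> by auto
  qed (use z in simp)
qed

lemma range_Lmat_iff:
  assumes p: "p \<in> carrier_vec (n+1)"
  shows "(\<exists>z\<in>carrier_vec 2. p = Lmat t n *\<^sub>v z) \<longleftrightarrow> (\<exists>a b. \<forall>i<n+1. p $ i = a + b * t (Suc i))"
proof
  assume "\<exists>z\<in>carrier_vec 2. p = Lmat t n *\<^sub>v z"
  then show "\<exists>a b. \<forall>i<n+1. p $ i = a + b * t (Suc i)" using Lmat_mult_vec by blast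
next
  assume "\<exists>a b. \<forall>i<n+1. p $ i = a + b * t (Suc i)"
  then obtain a b where ab: "\<forall>i<n+1. p $ i = a + b * t (Suc i)" by blast
  let ?z = "vec 2 (\<lambda>j. if j = 0 then a else b)"
  have "p = Lmat t n *\<^sub>v ?z"
    using p ab Lmat_mult_vec[of ?z] by (intro eq_vecI) (auto simp: Lmat_def)
  then show "\<exists>z\<in>carrier_vec 2. p = Lmat t n *\<^sub>v z" by auto
qed

lemma Cmat_wvec_eq_0_iff:
  assumes p: "p \<in> carrier_vec (n+1)"
  shows "Cmat t n *\<^sub>v wvec n u1 p u2 = 0\<^sub>v (n+3) \<longleftrightarrow>
           u1 = 0 \<and> u2 = 0 \<and> (\<exists>z\<in>carrier_vec 2. p = Lmat t n *\<^sub>v z)"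
proof -
  let ?w = "wvec n u1 p u2"
  have shift: "(\<forall>i\<in>{1..n+1}. p $ (i - 1) = a + b * t i) \<longleftrightarrow> (\<forall>i<n+1. p $ i = a + b * t (Suc i))"
    for a b
  proof (intro iffI allI ballI impI)
    fix i assume "\<forall>i\<in>{1..n+1}. p $ (i - 1) = a + b * t i" "i < n + 1"
    then show "p $ i = a + b * t (Suc i)" by force
  next
    fix i assume h: "\<forall>i<n+1. p $ i = a + b * t (Suc i)" and "i \<in> {1..n+1}"
    then obtain j where "i = Suc j" "j < n + 1" by (cases i) auto
    then show "p $ (i - 1) = a + b * t i" using h by simp
  qed
  have "Cmat t n *\<^sub>v ?w = 0\<^sub>v (n+3) \<longleftrightarrow> (\<forall>x\<in>I. phi2_comb (\<lambda>l. ?w $ l) x = 0)"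
    unfolding Cmat_eq_gram_mat phi2_comb_def
    by (rule gram_mat_mult_vec_eq_0_iff[OF continuous_on_phi2 first_knot_less_last])
      (simp add: wvec_def)
  also have "\<dots> \<longleftrightarrow> u1 = 0 \<and> u2 = 0 \<and> (\<exists>a b. \<forall>i\<in>{1..n+1}. p $ (i - 1) = a + b * t i)"
    unfolding phi2_comb_eq_0_iff by (simp add: wvec_def)
  finally show ?thesis unfolding shift range_Lmat_iff[OF p] .
qed

lemma Csub_combination:
  "(\<Sum>j<n+1. p $ j * phi2 t n (Suc j) x) = phi2_comb (\<lambda>l. wvec n 0 p 0 $ l) x"
proof -
  have "n + 3 = Suc (Suc n + 1)" by simp
  then have "phi2_comb (\<lambda>l. wvec n 0 p 0 $ l) x
      = (\<Sum>l<Suc n + 1. wvec n 0 p 0 $ Suc l * phi2 t n (Suc l) x)"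
    unfolding phi2_comb_def by (simp only: sum.lessThan_Suc_shift) (simp add: wvec_def)
  also have "\<dots> = (\<Sum>j<n+1. p $ j * phi2 t n (Suc j) x)"
    by (simp add: wvec_def)
  finally show ?thesis by simp
qed

lemma Csub_kernel:
  assumes p: "p \<in> carrier_vec (n+1)"
  shows "Csub t n *\<^sub>v p = 0\<^sub>v (n+1) \<longleftrightarrow> (\<exists>z\<in>carrier_vec 2. p = Lmat t n *\<^sub>v z)"
    and "p \<bullet> (Csub t n *\<^sub>v p) = 0 \<longleftrightarrow> (\<exists>z\<in>carrier_vec 2. p = Lmat t n *\<^sub>v z)"
proof -
  have w: "wvec n 0 p 0 \<in> carrier_vec (n+3)" by (simp add: wvec_def)
  have "(\<forall>x\<in>I. (\<Sum>j<n+1. p $ j * phi2 t n (Suc j) x) = 0) \<longleftrightarrow> Cmat t n *\<^sub>v wvec n 0 p 0 = 0\<^sub>v (n+3)"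
    unfolding Csub_combination Cmat_eq_gram_mat
    using gram_mat_mult_vec_eq_0_iff[OF continuous_on_phi2 first_knot_less_last w]
    by (simp add: phi2_comb_def)
  also have "\<dots> \<longleftrightarrow> (\<exists>z\<in>carrier_vec 2. p = Lmat t n *\<^sub>v z)" by (simp add: Cmat_wvec_eq_0_iff[OF p])
  finally have comb: "(\<forall>x\<in>I. (\<Sum>j<n+1. p $ j * phi2 t n (Suc j) x) = 0) \<longleftrightarrow>
      (\<exists>z\<in>carrier_vec 2. p = Lmat t n *\<^sub>v z)" .
  show "Csub t n *\<^sub>v p = 0\<^sub>v (n+1) \<longleftrightarrow> (\<exists>z\<in>carrier_vec 2. p = Lmat t n *\<^sub>v z)"
    unfolding Csub_eq_gram_mat comb[symmetric]
    by (rule gram_mat_mult_vec_eq_0_iff[OF continuous_on_phi2 first_knot_less_last p])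
  show "p \<bullet> (Csub t n *\<^sub>v p) = 0 \<longleftrightarrow> (\<exists>z\<in>carrier_vec 2. p = Lmat t n *\<^sub>v z)"
    unfolding Csub_eq_gram_mat comb[symmetric]
    by (rule gram_mat_form_eq_0_iff[OF continuous_on_phi2 first_knot_less_last p])
qed

lemma Csub_psd: "psd_matrix (n+1) (Csub t n)"
  unfolding Csub_eq_gram_mat by (rule gram_mat_psd[OF continuous_on_phi2])

lemma transpose_Csub: "transpose_mat (Csub t n) = Csub t n"
  unfolding Csub_eq_gram_mat by (rule transpose_gram_mat[OF continuous_on_phi2])

lemma Hmat_eq_resolvent: "Hmat t n = psd_matrix.resolvent (n+1) (Csub t n)"
  using Csub_psd by (simp add: fun_eq_iff Hmat_def psd_matrix.resolvent_def)

text \<open>Splitting \<open>y = P y + C s\<close> along \<open>ker C = range L\<close> and its orthogonal complement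
  \<open>range C\<close>.\<close>
lemma Hmat_tendsto_proj:
  assumes y: "y \<in> carrier_vec (n+1)" and i: "i < n + 1"
  shows "((\<lambda>lam. (Hmat t n lam *\<^sub>v y) $ i) \<longlongrightarrow> (proj_mat (Lmat t n) *\<^sub>v y) $ i) at_top"
proof -
  interpret C: psd_matrix "n+1" "Csub t n" by (rule Csub_psd)
  interpret L: full_column_rank "Lmat t n" "n+1" 2 by (rule Lmat_full_column_rank)
  define P where "P = proj_mat (Lmat t n) *\<^sub>v y"
  have P: "P \<in> carrier_vec (n+1)" unfolding P_def by (rule L.proj_mat_mult_vec_carrier[OF y])
  have CP: "Csub t n *\<^sub>v P = 0\<^sub>v (n+1)"
    using Csub_kernel(1)[OF P] L.proj_in_range[OF y] unfolding P_def by simp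
  have CL: "Csub t n *\<^sub>v (Lmat t n *\<^sub>v z) = 0\<^sub>v (n+1)" if "z \<in> carrier_vec 2" for z
    using Csub_kernel(1)[of "Lmat t n *\<^sub>v z"] L.L_carrier that by auto
  have ker: "\<exists>z\<in>carrier_vec 2. v = Lmat t n *\<^sub>v z"
    if "v \<in> carrier_vec (n+1)" "v \<bullet> (Csub t n *\<^sub>v v) = 0" for v
    using Csub_kernel(2) that by blast
  have r: "y - P \<in> carrier_vec (n+1)" using y P by simp
  obtain s where s: "s \<in> carrier_vec (n+1)" and Cs: "Csub t n *\<^sub>v s = y - P"
    using L.psd_solvable_if_orthogonal_to_range[OF Csub_psd transpose_Csub CL ker r
        L.transpose_mult_residual[OF y, folded P_def]] by blast
  have "y = P + Csub t n *\<^sub>v s" using Cs y P by (intro eq_vecI) auto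
  then show ?thesis
    using C.resolvent_tendsto_kernel[OF P CP s i] unfolding Hmat_eq_resolvent P_def by simp
qed

lemma Cmat_kernel_least_squares:
  assumes y: "y \<in> carrier_vec (n+1)" and p: "p \<in> carrier_vec (n+1)"
    and C: "Cmat t n *\<^sub>v wvec n u1 p u2 = 0\<^sub>v (n+3)"
  defines "P \<equiv> proj_mat (Lmat t n) *\<^sub>v y"
  shows "(y - P) \<bullet> (y - P) \<le> (y - p) \<bullet> (y - p)"
    and "(y - p) \<bullet> (y - p) \<le> (y - P) \<bullet> (y - P) \<Longrightarrow> u1 = 0 \<and> u2 = 0 \<and> p = P"
proof -
  interpret L: full_column_rank "Lmat t n" "n+1" 2 by (rule Lmat_full_column_rank)
  obtain z where z: "z \<in> carrier_vec 2" and "p = Lmat t n *\<^sub>v z" "u1 = 0" "u2 = 0"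
    using C Cmat_wvec_eq_0_iff[OF p] by blast
  then show "(y - P) \<bullet> (y - P) \<le> (y - p) \<bullet> (y - p)"
    and "(y - p) \<bullet> (y - p) \<le> (y - P) \<bullet> (y - P) \<Longrightarrow> u1 = 0 \<and> u2 = 0 \<and> p = P"
    using L.proj_least_squares[OF y z] unfolding P_def by auto
qed

end

theorem corollary1:
  fixes t :: "nat \<Rightarrow> real" and n :: nat
  assumes n1: "n \<ge> 1"
    and tmono: "\<forall>i\<in>{1..n}. t i < t (Suc i)"
  shows
    "(\<forall>i < n+1. \<forall>j < n+1.
        ((\<lambda>lam. Hmat t n lam $$ (i,j)) \<longlongrightarrow> 1\<^sub>m (n+1) $$ (i,j)) (at_right 0))
     \<and>
     (\<forall>y \<in> carrier_vec (n+1).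
        let L = Lmat t n;
            P = (L * the (mat_inverse (transpose_mat L * L)) * transpose_mat L) *\<^sub>v y
        in (\<forall>i < n+1. ((\<lambda>lam. (Hmat t n lam *\<^sub>v y) $ i) \<longlongrightarrow> P $ i) at_top)
         \<and> (\<exists>z \<in> carrier_vec 2. P = L *\<^sub>v z)
         \<and> (\<forall>z \<in> carrier_vec 2. scalar_prod (y - P) (L *\<^sub>v z) = 0)
         \<and> Cmat t n *\<^sub>v wvec n 0 P 0 = 0\<^sub>v (n+3)
         \<and> (\<forall>u1 u2. \<forall>p \<in> carrier_vec (n+1).
              Cmat t n *\<^sub>v wvec n u1 p u2 = 0\<^sub>v (n+3) \<longrightarrow>
              scalar_prod (y - P) (y - P) \<le> scalar_prod (y - p) (y - p)
              \<and> (scalar_prod (y - p) (y - p) \<le> scalar_prod (y - P) (y - P)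
                   \<longrightarrow> u1 = 0 \<and> u2 = 0 \<and> p = P)))"
proof -
  interpret knots t n using n1 tmono by unfold_locales
  interpret C: psd_matrix "n+1" "Csub t n" by (rule Csub_psd)
  interpret L: full_column_rank "Lmat t n" "n+1" 2 by (rule Lmat_full_column_rank)
  have "(\<exists>z\<in>carrier_vec 2. proj_mat (Lmat t n) *\<^sub>v y = Lmat t n *\<^sub>v z)
      \<and> Cmat t n *\<^sub>v wvec n 0 (proj_mat (Lmat t n) *\<^sub>v y) 0 = 0\<^sub>v (n+3)" if y: "y \<in> carrier_vec (n+1)" for y
    using L.proj_in_range[OF y] Cmat_wvec_eq_0_iff[OF L.proj_mat_mult_vec_carrier[OF y]] by simp
  then show ?thesis
    unfolding Let_def proj_mat_def[symmetric] Hmat_eq_resolvent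
    using C.resolvent_tendsto_one Hmat_tendsto_proj[unfolded Hmat_eq_resolvent]
      L.proj_orthogonal Cmat_kernel_least_squares by simp
qed

end
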